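(* Let $\xi\in\mathbb{R}^n$. A pair of admissible controls $(\mathbf{u}^*,\mathbf{v}^* )\in\mathcal{U}\times\mathcal{V}$ is an open-loop Nash equilibrium point of the game (DTSDG) with initial state $\xi$ if and only if $$\langle \mathcal{J}_1'(0,\xi;\mathbf{u}^*,\mathbf{v}^* ),\mathbf{w}\rangle=0\quad\forall\,\mathbf{w}\in\mathcal{U},$$ and $$\langle \mathcal{J}_2'(0,\xi;\mathbf{u}^*,\mathbf{v}^* ),\mathbf{z}\rangle=0\quad\forall\,\mathbf{z}\in\mathcal{V}.$$ Here $\mathcal{J}_1'(0,\xi;\mathbf{u},\mathbf{v})$ denotes the Gâteaux derivative of $\mathbf{u}\mapsto\mathcal{J}_1(0,\xi;\mathbf{u},\mathbf{v})$ at $\mathbf{u}$, and $\mathcal{J}_2'(0,\xi;\mathbf{u},\mathbf{v})$ denotes the Gâteaux derivative of $\mathbf{v}\mapsto\mathcal{J}_2(0,\xi;\mathbf{u},\mathbf{v})$ at $\mathbf{v}$.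
   Context: Probability setting. $N$ is a positive integer, $\mathcal{T}=\{0,\dots,N-1\}$, $\overline{\mathcal{T}}=\{0,\dots,N\}$. On a complete probability space $(\Omega,\mathcal{F},\mathbb{P})$ let $(\omega_k)_{k\in\mathcal{T}}$ be real random variables, $\mathcal{F}_k=\sigma(\omega_0,\dots,\omega_k)$ for $k\in\mathcal{T}$ (filtration taken $\mathbb{P}$-complete), $\mathcal{F}_{-1}=\{\emptyset,\Omega\}$, with $\mathbb{E}[\omega_k\mid\mathcal{F}_{k-1}]=0$, $\mathbb{E}[\omega_k^2\mid\mathcal{F}_{k-1}]=1$, $\mathbb{E}[\omega_k^4]<\infty$ for all $k\in\mathcal T$. Spaces. For a finite-dimensional real space $E$ and $I\in\{\mathcal{T},\overline{\mathcal{T}}\}$, $L^2_{\mathbb{F}}(I;E)$ is the set of $E$-valued processes $(f_k)_{k\in I}$ with $f_k$ $\mathcal{F}_{k-1}$-measurable and $\mathbb{E}\sum_{k\in I}|f_k|^2<\infty$; $L^\infty_{\mathbb{F}}(I;E)$ is the set of essentially bounded such processes; $L^2_{\mathcal{F}_{N-1}}(\Omega;E)$, $L^\infty_{\mathcal{F}_{N-1}}(\Omega;E)$ are the square integrable, resp. essentially bounded, $\mathcal{F}_{N-1}$-measurable $E$-valued random variables. $\mathcal{U}=L^2_{\mathbb{F}}(\mathcal{T};\mathbb{R}^m)$ and $\mathcal{V}=L^2_{\mathbb{F}}(\mathcal{T};\mathbb{R}^l)$ are the admissible controls of Players 1 and 2. State equation. For $\xi\in\mathbb{R}^n$, $\mathbf{u}\in\mathcal{U}$,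 $\mathbf{v}\in\mathcal{V}$: $x_0=\xi$ and, for $k\in\mathcal{T}$, $$x_{k+1}=A_kx_k+B_ku_k+C_kv_k+b_k+(D_kx_k+E_ku_k+F_kv_k+\sigma_k)\omega_k .$$ Costs. $$\mathcal{J}_1(0,\xi;\mathbf{u},\mathbf{v})=\tfrac12\mathbb{E}\Big\{\langle G_Nx_N,x_N\rangle+2\langle g_N,x_N\rangle+\sum_{k=0}^{N-1}\big[\langle Q_kx_k,x_k\rangle+2\langle L_k^\top u_k,x_k\rangle+\langle R_ku_k,u_k\rangle+2\langle q_k,x_k\rangle+2\langle\rho_k,u_k\rangle\big]\Big\},$$ $$\mathcal{J}_2(0,\xi;\mathbf{u},\mathbf{v})=\tfrac12\mathbb{E}\Big\{\langle H_Nx_N,x_N\rangle+2\langle h_N,x_N\rangle+\sum_{k=0}^{N-1}\big[\langle P_kx_k,x_k\rangle+2\langle M_k^\top v_k,x_k\rangle+\langle S_kv_k,v_k\rangle+2\langle p_k,x_k\rangle+2\langle\theta_k,v_k\rangle\big]\Big\}.$$ Assumptions on coefficients. $A,D\in L^\infty_{\mathbb{F}}(\mathcal{T};\mathbb{R}^{n\times n})$, $B,E\in L^\infty_{\mathbb{F}}(\mathcal{T};\mathbb{R}^{n\times m})$, $C,F\in L^\infty_{\mathbb{F}}(\mathcal{T};\mathbb{R}^{n\times l})$, $b,\sigma\in L^2_{\mathbb{F}}(\mathcal{T};\mathbb{R}^n)$; $Q,P\in L^\infty_{\mathbb{F}}(\mathcal{T};\mathbb{R}^{n\times n})$, $L\in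 L^\infty_{\mathbb{F}}(\mathcal{T};\mathbb{R}^{m\times n})$, $M\in L^\infty_{\mathbb{F}}(\mathcal{T};\mathbb{R}^{l\times n})$, $R\in L^\infty_{\mathbb{F}}(\mathcal{T};\mathbb{R}^{m\times m})$, $S\in L^\infty_{\mathbb{F}}(\mathcal{T};\mathbb{R}^{l\times l})$, $G_N,H_N\in L^\infty_{\mathcal{F}_{N-1}}(\Omega;\mathbb{R}^{n\times n})$, $g_N,h_N\in L^2_{\mathcal{F}_{N-1}}(\Omega;\mathbb{R}^n)$, $q,p\in L^2_{\mathbb{F}}(\mathcal{T};\mathbb{R}^n)$, $\rho\in L^2_{\mathbb{F}}(\mathcal{T};\mathbb{R}^m)$, $\theta\in L^2_{\mathbb{F}}(\mathcal{T};\mathbb{R}^l)$. The matrices $Q_k,P_k,R_k,S_k,G_N,H_N$ are symmetric, and there is a constant $\delta>0$ such that, almost surely for all $k\in\mathcal{T}$: $G_N,H_N\succeq0$, $R_k,S_k\succeq\delta I$, $Q_k-L_k^\top R_k^{-1}L_k\succeq0$, $P_k-M_k^\top S_k^{-1}M_k\succeq0$. Nash equilibrium. $(\mathbf{u}^*,\mathbf{v}^* )\in\mathcal{U}\times\mathcal{V}$ is an open-loop Nash equilibrium point of (DTSDG) for the initial state $\xi$ if $\mathcal{J}_1(0,\xi;\mathbf{u}^*,\mathbf{v}^* )=\inf_{\mathbf{u}\in\mathcal{U}}\mathcal{J}_1(0,\xi;\mathbf{u},\mathbf{v}^* )$ and $\mathcal{J}_2(0,\xi;\mathbf{u}^*,\mathbf{v}^*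 )=\inf_{\mathbf{v}\in\mathcal{V}}\mathcal{J}_2(0,\xi;\mathbf{u}^*,\mathbf{v})$. *)

theory Defs
  imports "HOL-Probability.Probability"
begin

section \<open>Noise, filtration and spaces of processes\<close>

text \<open>
  Index shift: \<open>past \<mu> \<omega> k\<close> is the paper's \<open>\<F>\<^sub>k\<^sub>-\<^sub>1\<close>. It is trivial for \<open>k = 0\<close>, and for \<open>k > 0\<close> it is
  generated by \<open>\<omega>\<^sub>0, \<dots>, \<omega>\<^sub>k\<^sub>-\<^sub>1\<close> and the null sets. Only its space and its measurable sets matter.
\<close>

definition past :: "'a measure \<Rightarrow> (nat \<Rightarrow> 'a \<Rightarrow> real) \<Rightarrow> nat \<Rightarrow> 'a measure" where
  "past \<mu> \<omega> k =
    (if k = 0 then sigma (space \<mu>) {}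
     else sigma (space \<mu>)
       ({\<omega> j -` X \<inter> space \<mu> | j X. j < k \<and> X \<in> sets borel} \<union> null_sets \<mu>))"

definition noise :: "'a measure \<Rightarrow> nat \<Rightarrow> (nat \<Rightarrow> 'a \<Rightarrow> real) \<Rightarrow> bool" where
  "noise \<mu> N \<omega> \<longleftrightarrow>
    (\<forall>k<N. \<omega> k \<in> borel_measurable \<mu> \<and>
      integrable \<mu> (\<lambda>z. \<omega> k z ^ 4) \<and>
      (AE z in \<mu>. real_cond_exp \<mu> (past \<mu> \<omega> k) (\<omega> k) z = 0) \<and>
      (AE z in \<mu>. real_cond_exp \<mu> (past \<mu> \<omega> k) (\<lambda>y. (\<omega> k y)\<^sup>2) z = 1))"

definition L2_rv :: "'a measure \<Rightarrow> 'a measure \<Rightarrow> ('a \<Rightarrow> 'b::euclidean_space) set" where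
  "L2_rv \<mu> F = {f \<in> borel_measurable F. integrable \<mu> (\<lambda>z. (norm (f z))\<^sup>2)}"

definition Linf_rv :: "'a measure \<Rightarrow> 'a measure \<Rightarrow> ('a \<Rightarrow> 'b::euclidean_space) set" where
  "Linf_rv \<mu> F = {f \<in> borel_measurable F. \<exists>K. AE z in \<mu>. norm (f z) \<le> K}"

text \<open>
  Processes over the index set \<open>I\<close> are represented by functions on all of \<open>nat\<close> whose values outside
  \<open>I\<close> are unconstrained and irrelevant; a.s. equal processes are not identified.
\<close>

definition L2_proc ::
    "'a measure \<Rightarrow> (nat \<Rightarrow> 'a \<Rightarrow> real) \<Rightarrow> nat set \<Rightarrow> (nat \<Rightarrow> 'a \<Rightarrow> 'b::euclidean_space) set" where
  "L2_proc \<mu> \<omega> I =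
    {f. (\<forall>k\<in>I. f k \<in> borel_measurable (past \<mu> \<omega> k)) \<and>
        integrable \<mu> (\<lambda>z. \<Sum>k\<in>I. (norm (f k z))\<^sup>2)}"

definition L2_norm :: "'a measure \<Rightarrow> nat set \<Rightarrow> (nat \<Rightarrow> 'a \<Rightarrow> 'b::euclidean_space) \<Rightarrow> real" where
  "L2_norm \<mu> I f = sqrt (\<integral>z. (\<Sum>k\<in>I. (norm (f k z))\<^sup>2) \<partial>\<mu>)"

definition Linf_proc ::
    "'a measure \<Rightarrow> (nat \<Rightarrow> 'a \<Rightarrow> real) \<Rightarrow> nat set \<Rightarrow> (nat \<Rightarrow> 'a \<Rightarrow> 'b::euclidean_space) set" where
  "Linf_proc \<mu> \<omega> I =
    {f. (\<forall>k\<in>I. f k \<in> borel_measurable (past \<mu> \<omega> k)) \<and>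
        (\<exists>K. AE z in \<mu>. \<forall>k\<in>I. norm (f k z) \<le> K)}"

section \<open>State equation and quadratic costs\<close>

primrec state ::
    "(nat \<Rightarrow> 'a \<Rightarrow> real) \<Rightarrow> (nat \<Rightarrow> 'a \<Rightarrow> real^'n^'n) \<Rightarrow> (nat \<Rightarrow> 'a \<Rightarrow> real^'m^'n) \<Rightarrow>
     (nat \<Rightarrow> 'a \<Rightarrow> real^'l^'n) \<Rightarrow> (nat \<Rightarrow> 'a \<Rightarrow> real^'n) \<Rightarrow>
     (nat \<Rightarrow> 'a \<Rightarrow> real^'n^'n) \<Rightarrow> (nat \<Rightarrow> 'a \<Rightarrow> real^'m^'n) \<Rightarrow>
     (nat \<Rightarrow> 'a \<Rightarrow> real^'l^'n) \<Rightarrow> (nat \<Rightarrow> 'a \<Rightarrow> real^'n) \<Rightarrow> real^'n \<Rightarrow>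
     (nat \<Rightarrow> 'a \<Rightarrow> real^'m) \<Rightarrow> (nat \<Rightarrow> 'a \<Rightarrow> real^'l) \<Rightarrow> nat \<Rightarrow> 'a \<Rightarrow> real^'n" where
  "state \<omega> A B C b D E F \<sigma> \<xi> u v 0 = (\<lambda>z. \<xi>)"
| "state \<omega> A B C b D E F \<sigma> \<xi> u v (Suc k) = (\<lambda>z.
     A k z *v state \<omega> A B C b D E F \<sigma> \<xi> u v k z + B k z *v u k z + C k z *v v k z + b k z +
     \<omega> k z *\<^sub>R
       (D k z *v state \<omega> A B C b D E F \<sigma> \<xi> u v k z + E k z *v u k z + F k z *v v k z + \<sigma> k z))"

text \<open>
  The two cost functionals have the same shape, each depending directly only on the state and on the
  player's own control \<open>u\<close>.
\<close>

definition quadratic_cost ::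
    "'a measure \<Rightarrow> nat \<Rightarrow> ('a \<Rightarrow> real^'n^'n) \<Rightarrow> ('a \<Rightarrow> real^'n) \<Rightarrow>
     (nat \<Rightarrow> 'a \<Rightarrow> real^'n^'n) \<Rightarrow> (nat \<Rightarrow> 'a \<Rightarrow> real^'n^'m) \<Rightarrow> (nat \<Rightarrow> 'a \<Rightarrow> real^'m^'m) \<Rightarrow>
     (nat \<Rightarrow> 'a \<Rightarrow> real^'n) \<Rightarrow> (nat \<Rightarrow> 'a \<Rightarrow> real^'m) \<Rightarrow>
     (nat \<Rightarrow> 'a \<Rightarrow> real^'n) \<Rightarrow> (nat \<Rightarrow> 'a \<Rightarrow> real^'m) \<Rightarrow> real" where
  "quadratic_cost \<mu> N G g Q L R q \<rho> x u =
    1/2 * (\<integral>z. ((G z *v x N z) \<bullet> x N z + 2 * (g z \<bullet> x N z) +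
      (\<Sum>k<N. (Q k z *v x k z) \<bullet> x k z + 2 * ((transpose (L k z) *v u k z) \<bullet> x k z) +
              (R k z *v u k z) \<bullet> u k z + 2 * (q k z \<bullet> x k z) + 2 * (\<rho> k z \<bullet> u k z))) \<partial>\<mu>)"

definition psd :: "real^'n^'n \<Rightarrow> bool" where
  "psd X \<longleftrightarrow> transpose X = X \<and> (\<forall>y. 0 \<le> (X *v y) \<bullet> y)"

section \<open>Nash equilibria and Gateaux derivatives\<close>

text \<open>
  The infima are taken in the extended reals, so that they are meaningful whether or not the costs
  are bounded below.
\<close>

definition open_loop_nash ::
    "'u set \<Rightarrow> 'v set \<Rightarrow> ('u \<Rightarrow> 'v \<Rightarrow> real) \<Rightarrow> ('u \<Rightarrow> 'v \<Rightarrow> real) \<Rightarrow> 'u \<Rightarrow> 'v \<Rightarrow> bool" where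
  "open_loop_nash U V J1 J2 us vs \<longleftrightarrow>
    us \<in> U \<and> vs \<in> V \<and>
    ereal (J1 us vs) = (INF u\<in>U. ereal (J1 u vs)) \<and>
    ereal (J2 us vs) = (INF v\<in>V. ereal (J2 us v))"

text \<open>
  Gateaux differentiability on a space \<open>V\<close> of processes with (semi)norm \<open>nrm\<close>: all directional
  derivatives exist and form a bounded linear functional \<open>\<Lambda>\<close> on \<open>V\<close>.
\<close>

definition has_gateaux_derivative ::
    "(nat \<Rightarrow> 'a \<Rightarrow> 'b::real_normed_vector) set \<Rightarrow> ((nat \<Rightarrow> 'a \<Rightarrow> 'b) \<Rightarrow> real) \<Rightarrow>
     ((nat \<Rightarrow> 'a \<Rightarrow> 'b) \<Rightarrow> real) \<Rightarrow> ((nat \<Rightarrow> 'a \<Rightarrow> 'b) \<Rightarrow> real) \<Rightarrow> (nat \<Rightarrow> 'a \<Rightarrow> 'b) \<Rightarrow> bool" where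
  "has_gateaux_derivative V nrm J \<Lambda> u \<longleftrightarrow>
    (\<forall>w1\<in>V. \<forall>w2\<in>V. \<forall>a b. \<Lambda> (\<lambda>k z. a *\<^sub>R w1 k z + b *\<^sub>R w2 k z) = a * \<Lambda> w1 + b * \<Lambda> w2) \<and>
    (\<exists>K. \<forall>w\<in>V. \<bar>\<Lambda> w\<bar> \<le> K * nrm w) \<and>
    (\<forall>w\<in>V. ((\<lambda>t::real. (J (\<lambda>k z. u k z + t *\<^sub>R w k z) - J u) / t) \<longlongrightarrow> \<Lambda> w) (at 0))"

definition gateaux_differentiable ::
    "(nat \<Rightarrow> 'a \<Rightarrow> 'b::real_normed_vector) set \<Rightarrow> ((nat \<Rightarrow> 'a \<Rightarrow> 'b) \<Rightarrow> real) \<Rightarrow>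
     ((nat \<Rightarrow> 'a \<Rightarrow> 'b) \<Rightarrow> real) \<Rightarrow> (nat \<Rightarrow> 'a \<Rightarrow> 'b) \<Rightarrow> bool" where
  "gateaux_differentiable V nrm J u \<longleftrightarrow> (\<exists>\<Lambda>. has_gateaux_derivative V nrm J \<Lambda> u)"

text \<open>
  \<open>gateaux_deriv J u w\<close> is the pairing of the derivative of \<open>J\<close> at \<open>u\<close> with the direction \<open>w\<close>; it is
  meaningful only together with differentiability, as the lemma below states.
\<close>

definition gateaux_deriv ::
    "((nat \<Rightarrow> 'a \<Rightarrow> 'b::real_normed_vector) \<Rightarrow> real) \<Rightarrow> (nat \<Rightarrow> 'a \<Rightarrow> 'b) \<Rightarrow>
     (nat \<Rightarrow> 'a \<Rightarrow> 'b) \<Rightarrow> real" where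
  "gateaux_deriv J u w = Lim (at 0) (\<lambda>t::real. (J (\<lambda>k z. u k z + t *\<^sub>R w k z) - J u) / t)"

lemma has_gateaux_derivative_imp_gateaux_deriv:
  assumes "has_gateaux_derivative V nrm J \<Lambda> u" and "w \<in> V"
  shows "gateaux_deriv J u w = \<Lambda> w"
  unfolding gateaux_deriv_def
  by (rule tendsto_Lim) (use assms in \<open>auto simp: has_gateaux_derivative_def\<close>)

end

theory Submission
  imports Defs
begin

text \<open>
  With the opponent's control fixed, the state is an affine function of a player's own control:
  replacing \<open>u\<close> by \<open>u + t w\<close> adds \<open>t y\<close> to the state, where \<open>y\<close>, the response to \<open>w\<close>, solves the
  homogeneous state equation (lemma \<open>state_perturb\<close>). A quadratic cost is therefore exactly quadratic
  along each line,
  \<open>J (u + t w) = J u + t J' u w + t\<^sup>2 J2 w\<close>,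
  where \<open>J2 w\<close> is the same cost, without its linear terms, evaluated at \<open>(y, w)\<close> (lemma
  \<open>cost_expansion\<close>).

  The coefficient \<open>J2 w\<close> is nonnegative: \<open>G\<close> is positive semidefinite, and completing the square in
  the running cost leaves \<open>R\<close> and the Schur complement \<open>Q - L\<^sup>T R\<inverse> L\<close>, both positive semidefinite (lemma
  \<open>complete_square\<close>). So each cost is convex in the player's own control, and for a quadratic
  function with nonnegative second-order coefficient minimality and stationarity coincide (lemma
  \<open>minimal_iff_stationary_if_convex_quadratic\<close>). A Nash equilibrium is a pair of simultaneous
  minimality statements, one for each player.

  The remaining part is analytic. All integrals must exist, and the linear term must be a bounded functional
  of \<open>w\<close> for it to be a Gateaux derivative. Both rest on the fact that the noise acts isometrically on square
  integrable random variables known beforehand (lemma \<open>integral_norm2_noise\<close>), because its conditional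
  second moment is 1. Hence the state is square integrable (lemma \<open>state_L2\<close>), and the second moments
  of the response are bounded by a multiple of the squared norm of \<open>w\<close> (lemma \<open>response_bounded\<close>).
\<close>


section \<open>Matrix inequalities and measurability\<close>

lemma norm_matrix_vector_mult_le:
  fixes A :: "real^'n^'m"
  shows "norm (A *v x) \<le> norm A * norm x"
proof -
  have "norm (A *v x) = L2_set (\<lambda>i. \<bar>A $ i \<bullet> x\<bar>) UNIV"
    by (simp add: norm_vec_def matrix_vector_mul_component)
  also have "\<dots> \<le> L2_set (\<lambda>i. norm (A $ i) * norm x) UNIV"
    by (rule L2_set_mono) (simp_all add: Cauchy_Schwarz_ineq2)
  also have "\<dots> = norm A * norm x"
    by (simp add: norm_vec_def L2_set_left_distrib)
  finally show ?thesis .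
qed

lemma bounded_bilinear_matrix_vector_mult:
  "bounded_bilinear ((*v) :: real^'n^'m \<Rightarrow> real^'n \<Rightarrow> real^'m)"
proof
  show "\<exists>K. \<forall>(A :: real^'n^'m) x. norm (A *v x) \<le> norm A * norm x * K"
    by (intro exI[of _ 1]) (simp add: norm_matrix_vector_mult_le)
qed (simp_all add: matrix_vector_mult_add_rdistrib matrix_vector_right_distrib
      scaleR_matrix_vector_assoc matrix_vector_mult_scaleR)

lemma borel_measurable_matrix_vector_mult [measurable (raw)]:
  fixes A :: "'a \<Rightarrow> real^'n^'m"
  assumes "A \<in> borel_measurable F" "x \<in> borel_measurable F"
  shows "(\<lambda>z. A z *v x z) \<in> borel_measurable F"
  using assms
  by (rule borel_measurable_continuous_Pair)
     (intro bounded_bilinear.continuous_on[OF bounded_bilinear_matrix_vector_mult] continuous_intros)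

lemma inner_transpose_mult:
  fixes A :: "real^'n^'m"
  shows "(transpose A *v x) \<bullet> y = x \<bullet> (A *v y)"
  by (simp add: dot_lmul_matrix)

lemma bounded_linear_transpose: "bounded_linear (transpose :: real^'n^'m \<Rightarrow> real^'m^'n)"
  by (rule linear_linear[THEN iffD2], rule linearI) (simp_all add: transpose_def vec_eq_iff)

text \<open>
  With \<open>a = R\<inverse> L y\<close> the left-over of the running cost is a sum of two nonnegative terms:
  \<open>\<langle>R (w + a), w + a\<rangle> + \<langle>(Q - L\<^sup>T R\<inverse> L) y, y\<rangle>\<close>. Coercivity of \<open>R\<close> makes it injective, hence invertible,
  so that \<open>matrix_inv R\<close> is a true inverse.
\<close>

lemma complete_square:
  fixes Q :: "real^'n^'n" and L :: "real^'n^'m" and R :: "real^'m^'m"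
  assumes "\<delta> > 0" and R: "psd (R - \<delta> *\<^sub>R mat 1)" and sym: "transpose R = R"
    and Q: "psd (Q - transpose L ** matrix_inv R ** L)"
  shows "0 \<le> (Q *v y) \<bullet> y + 2 * ((transpose L *v w) \<bullet> y) + (R *v w) \<bullet> w"
proof -
  have coercive: "\<delta> * (x \<bullet> x) \<le> (R *v x) \<bullet> x" for x
  proof -
    have "0 \<le> ((R - \<delta> *\<^sub>R mat 1) *v x) \<bullet> x"
      using R by (auto simp: psd_def)
    then show ?thesis
      by (simp add: matrix_vector_mult_diff_rdistrib inner_diff_left flip: scaleR_matrix_vector_assoc)
  qed
  have "x = 0" if "R *v x = 0" for x
    using coercive[of x] \<open>\<delta> > 0\<close> that
    by (metis inner_eq_zero_iff inner_ge_zero inner_zero_left linorder_not_less mult_pos_pos order_le_less)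
  then have "invertible R"
    by (simp add: invertible_left_inverse matrix_left_invertible_ker)
  then obtain R' where R': "R ** R' = mat 1 \<and> R' ** R = mat 1"
    unfolding invertible_def by blast
  have inv: "R ** matrix_inv R = mat 1"
    using someI[of "\<lambda>A. R ** A = mat 1 \<and> A ** R = mat 1", OF R'] by (simp add: matrix_inv_def)
  define a where "a = matrix_inv R *v (L *v y)"
  have Ra: "R *v a = L *v y"
    by (simp add: a_def matrix_vector_mul_assoc inv matrix_mul_assoc)
  have "0 \<le> (R *v (w + a)) \<bullet> (w + a)"
    using coercive[of "w + a"] \<open>\<delta> > 0\<close> by (meson dual_order.trans inner_ge_zero less_imp_le mult_nonneg_nonneg)
  moreover have "(R *v w) \<bullet> a = w \<bullet> (L *v y)"
    using inner_transpose_mult[of R w a] sym Ra by simp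
  moreover have "0 \<le> (Q *v y) \<bullet> y - a \<bullet> (L *v y)"
  proof -
    have "0 \<le> ((Q - transpose L ** matrix_inv R ** L) *v y) \<bullet> y"
      using Q by (auto simp: psd_def)
    moreover have "(transpose L ** matrix_inv R ** L) *v y = transpose L *v a"
      by (simp only: a_def matrix_vector_mul_assoc matrix_mul_assoc)
    ultimately show ?thesis
      by (simp only: matrix_vector_mult_diff_rdistrib inner_diff_left inner_transpose_mult)
  qed
  ultimately show ?thesis
    unfolding inner_transpose_mult
    by (simp add: matrix_vector_right_distrib inner_add Ra inner_commute)
qed

section \<open>Square integrable random variables\<close>

text \<open>
  In the space \<open>L2_rv M F\<close> the algebra \<open>F\<close> governs measurability only, while integrals are taken over \<open>M\<close>.
  Working over an arbitrary subalgebra lets the same closure properties serve both for the adapted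
  state (\<open>F\<close> is the past) and for the cost integrals (\<open>F = M\<close>).
\<close>

lemma L2_rv_mono:
  assumes "subalgebra M F" "subalgebra F F'" "f \<in> L2_rv M F'"
  shows "f \<in> L2_rv M F"
  using assms by (auto simp: L2_rv_def intro: measurable_from_subalg)

lemma subalgebra_refl: "subalgebra M M"
  by (simp add: subalgebra_def)

lemma L2_rv_weaken: "subalgebra M F \<Longrightarrow> f \<in> L2_rv M F \<Longrightarrow> f \<in> L2_rv M M"
  by (rule L2_rv_mono[OF subalgebra_refl])

lemma Linf_rv_weaken: "subalgebra M F \<Longrightarrow> f \<in> Linf_rv M F \<Longrightarrow> f \<in> Linf_rv M M"
  by (auto simp: Linf_rv_def intro: measurable_from_subalg)

lemma power2_norm_add_le:
  fixes a b :: "'b::real_inner"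
  shows "(norm (a + b))\<^sup>2 \<le> 2 * (norm a)\<^sup>2 + 2 * (norm b)\<^sup>2"
proof -
  have "(norm (a + b))\<^sup>2 \<le> (norm a + norm b)\<^sup>2"
    by (simp add: norm_triangle_ineq power_mono)
  also have "\<dots> \<le> 2 * (norm a)\<^sup>2 + 2 * (norm b)\<^sup>2"
    using sum_squares_bound[of "norm a" "norm b"] by (simp add: power2_sum)
  finally show ?thesis .
qed

lemma L2_rv_zero [simp]: "(\<lambda>z. 0) \<in> L2_rv M F"
  by (auto simp: L2_rv_def)

lemma
  assumes sub: "subalgebra M F" and f: "f \<in> L2_rv M F" and g: "g \<in> L2_rv M F"
  shows L2_rv_add: "(\<lambda>z. f z + g z) \<in> L2_rv M F"
    and integral_norm2_add_le:
      "(\<integral>z. (norm (f z + g z))\<^sup>2 \<partial>M) \<le> 2 * (\<integral>z. (norm (f z))\<^sup>2 \<partial>M) + 2 * (\<integral>z. (norm (g z))\<^sup>2 \<partial>M)"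
proof -
  have [measurable]: "f \<in> borel_measurable M" "g \<in> borel_measurable M"
    using f g by (auto simp: L2_rv_def intro: measurable_from_subalg[OF sub])
  have dom: "integrable M (\<lambda>z. 2 * (norm (f z))\<^sup>2 + 2 * (norm (g z))\<^sup>2)"
    using f g by (auto simp: L2_rv_def)
  have int: "integrable M (\<lambda>z. (norm (f z + g z))\<^sup>2)"
    by (rule Bochner_Integration.integrable_bound[OF dom]) (auto simp: power2_norm_add_le)
  then show "(\<lambda>z. f z + g z) \<in> L2_rv M F"
    using f g by (auto simp: L2_rv_def)
  have "(\<integral>z. (norm (f z + g z))\<^sup>2 \<partial>M) \<le> (\<integral>z. 2 * (norm (f z))\<^sup>2 + 2 * (norm (g z))\<^sup>2 \<partial>M)"
    by (rule integral_mono[OF int dom]) (rule power2_norm_add_le)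
  also have "\<dots> = 2 * (\<integral>z. (norm (f z))\<^sup>2 \<partial>M) + 2 * (\<integral>z. (norm (g z))\<^sup>2 \<partial>M)"
    using f g by (simp add: L2_rv_def)
  finally show "(\<integral>z. (norm (f z + g z))\<^sup>2 \<partial>M)
      \<le> 2 * (\<integral>z. (norm (f z))\<^sup>2 \<partial>M) + 2 * (\<integral>z. (norm (g z))\<^sup>2 \<partial>M)" .
qed

lemma L2_rv_scaleR: "f \<in> L2_rv M F \<Longrightarrow> (\<lambda>z. c *\<^sub>R f z) \<in> L2_rv M F"
  by (auto simp: L2_rv_def power_mult_distrib)

lemma
  fixes A :: "'a \<Rightarrow> real^'n^'m"
  assumes sub: "subalgebra M F" and A: "A \<in> borel_measurable F" and K: "AE z in M. norm (A z) \<le> K"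
    and f: "f \<in> L2_rv M F"
  shows L2_rv_matrix_mult_bounded: "(\<lambda>z. A z *v f z) \<in> L2_rv M F"
    and integral_norm2_matrix_mult_le:
      "(\<integral>z. (norm (A z *v f z))\<^sup>2 \<partial>M) \<le> K\<^sup>2 * (\<integral>z. (norm (f z))\<^sup>2 \<partial>M)"
proof -
  have [measurable]: "A \<in> borel_measurable M" "f \<in> borel_measurable M"
    using A f by (auto simp: L2_rv_def intro: measurable_from_subalg[OF sub])
  have dom: "integrable M (\<lambda>z. K\<^sup>2 * (norm (f z))\<^sup>2)"
    using f by (auto simp: L2_rv_def)
  have le: "AE z in M. (norm (A z *v f z))\<^sup>2 \<le> K\<^sup>2 * (norm (f z))\<^sup>2"
    using K
  proof eventually_elim
    case (elim z)
    have "norm (A z *v f z) \<le> K * norm (f z)"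
      using norm_matrix_vector_mult_le[of "A z" "f z"] mult_right_mono[OF elim, of "norm (f z)"] by simp
    then show ?case
      by (metis norm_ge_zero power_mono power_mult_distrib)
  qed
  have int: "integrable M (\<lambda>z. (norm (A z *v f z))\<^sup>2)"
    by (rule Bochner_Integration.integrable_bound[OF dom]) (use le in auto)
  then show "(\<lambda>z. A z *v f z) \<in> L2_rv M F"
    using A f by (auto simp: L2_rv_def)
  show "(\<integral>z. (norm (A z *v f z))\<^sup>2 \<partial>M) \<le> K\<^sup>2 * (\<integral>z. (norm (f z))\<^sup>2 \<partial>M)"
    using integral_mono_AE[OF int dom le] by simp
qed

lemma L2_rv_matrix_mult:
  fixes A :: "'a \<Rightarrow> real^'n^'m"
  assumes "subalgebra M F" "A \<in> Linf_rv M F" "f \<in> L2_rv M F"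
  shows "(\<lambda>z. A z *v f z) \<in> L2_rv M F"
  using assms L2_rv_matrix_mult_bounded[of M F A _ f] by (auto simp: Linf_rv_def)

lemma Linf_rv_transpose:
  fixes A :: "'a \<Rightarrow> real^'n^'m"
  assumes "A \<in> Linf_rv M F"
  shows "(\<lambda>z. transpose (A z)) \<in> Linf_rv M F"
proof -
  obtain K where K: "AE z in M. norm (A z) \<le> K" and A: "A \<in> borel_measurable F"
    using assms by (auto simp: Linf_rv_def)
  obtain C where C: "C > 0" "\<And>X :: real^'n^'m. norm (transpose X) \<le> norm X * C"
    using bounded_linear.pos_bounded[OF bounded_linear_transpose] by blast
  have "AE z in M. norm (transpose (A z)) \<le> K * C"
    using K
  proof eventually_elim
    case (elim z)
    then show ?case
      using C(2)[of "A z"] mult_right_mono[OF elim, of C] C(1) by linarith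
  qed
  moreover have "(\<lambda>z. transpose (A z)) \<in> borel_measurable F"
    by (rule measurable_compose[OF A borel_measurable_continuous_onI])
       (rule linear_continuous_on[OF bounded_linear_transpose])
  ultimately show ?thesis
    by (auto simp: Linf_rv_def)
qed

text \<open>
  The bound by a sum of squares, in place of the Cauchy-Schwarz product, is enough: a functional
  that is linear is bounded as soon as it grows at most quadratically.
\<close>

lemma
  assumes f: "f \<in> L2_rv M M" and g: "g \<in> L2_rv M M"
  shows integrable_inner_L2: "integrable M (\<lambda>z. f z \<bullet> g z)"
    and integral_inner_L2_le:
      "\<bar>\<integral>z. f z \<bullet> g z \<partial>M\<bar> \<le> (\<integral>z. (norm (f z))\<^sup>2 \<partial>M) + (\<integral>z. (norm (g z))\<^sup>2 \<partial>M)"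
proof -
  have [measurable]: "f \<in> borel_measurable M" "g \<in> borel_measurable M"
    using f g by (auto simp: L2_rv_def)
  have dom: "integrable M (\<lambda>z. (norm (f z))\<^sup>2 + (norm (g z))\<^sup>2)"
    using f g by (auto simp: L2_rv_def)
  have le: "\<bar>f z \<bullet> g z\<bar> \<le> (norm (f z))\<^sup>2 + (norm (g z))\<^sup>2" for z
    using Cauchy_Schwarz_ineq2[of "f z" "g z"] sum_squares_bound[of "norm (f z)" "norm (g z)"]
      mult_nonneg_nonneg[OF norm_ge_zero[of "f z"] norm_ge_zero[of "g z"]]
    unfolding mult.assoc by linarith
  show int: "integrable M (\<lambda>z. f z \<bullet> g z)"
    by (rule Bochner_Integration.integrable_bound[OF dom]) (use le in auto)
  have "\<bar>\<integral>z. f z \<bullet> g z \<partial>M\<bar> \<le> (\<integral>z. \<bar>f z \<bullet> g z\<bar> \<partial>M)"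
    by (rule integral_abs_bound)
  also have "\<dots> \<le> (\<integral>z. (norm (f z))\<^sup>2 + (norm (g z))\<^sup>2 \<partial>M)"
    by (rule integral_mono) (use int dom le in auto)
  finally show "\<bar>\<integral>z. f z \<bullet> g z \<partial>M\<bar> \<le> (\<integral>z. (norm (f z))\<^sup>2 \<partial>M) + (\<integral>z. (norm (g z))\<^sup>2 \<partial>M)"
    using f g by (simp add: L2_rv_def)
qed

section \<open>The noise and its filtration\<close>

lemma space_past [simp]: "space (past M \<omega> k) = space M"
  by (auto simp: past_def space_measure_of_conv)

locale noise_space = prob_space M for M :: "'a measure" +
  fixes N :: nat and \<omega> :: "nat \<Rightarrow> 'a \<Rightarrow> real"
  assumes noise: "noise M N \<omega>"
begin

lemma noise_measurable: "k < N \<Longrightarrow> \<omega> k \<in> borel_measurable M"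
  using noise by (auto simp: noise_def)

lemma generators_past:
  assumes "k \<le> N"
  shows "{\<omega> j -` X \<inter> space M | j X. j < k \<and> X \<in> sets borel} \<union> null_sets M \<subseteq> sets M"
  using assms by (auto intro!: measurable_sets[OF noise_measurable])

lemma sets_past:
  assumes "k \<le> N" "k > 0"
  shows "sets (past M \<omega> k) = sigma_sets (space M)
    ({\<omega> j -` X \<inter> space M | j X. j < k \<and> X \<in> sets borel} \<union> null_sets M)"
  using sets_measure_of[OF subset_trans[OF generators_past[OF assms(1)] sets.space_closed]] assms(2)
  by (simp add: past_def)

lemma subalgebra_past: "k \<le> N \<Longrightarrow> subalgebra M (past M \<omega> k)"
  using sets.sigma_sets_subset[OF generators_past[of k]]
  by (cases "k = 0") (auto simp: subalgebra_def sets_past, auto simp: past_def sigma_sets_empty_eq)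

lemma past_mono:
  assumes "j \<le> k" "k \<le> N"
  shows "subalgebra (past M \<omega> k) (past M \<omega> j)"
proof (cases "j = 0")
  case True
  then show ?thesis
    using sets.top[of "past M \<omega> k"] by (auto simp: subalgebra_def past_def[of M \<omega> 0] sigma_sets_empty_eq)
next
  case False
  have "sets (past M \<omega> j) \<subseteq> sets (past M \<omega> k)"
    unfolding sets_past[OF le_trans[OF assms] neq0_conv[THEN iffD1, OF False]]
      sets_past[OF assms(2) less_le_trans[OF neq0_conv[THEN iffD1, OF False] assms(1)]]
    by (rule sigma_sets_mono') (use assms(1) in \<open>fastforce intro: less_le_trans\<close>)
  then show ?thesis
    by (simp add: subalgebra_def)
qed

lemma noise_measurable_past:
  assumes "j < k" "k \<le> N"
  shows "\<omega> j \<in> borel_measurable (past M \<omega> k)"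
  by (rule measurableI) (use assms in \<open>auto simp: sets_past intro!: sigma_sets.Basic\<close>)

text \<open>
  Multiplication by \<open>\<omega>\<^sub>k\<close> is an isometry on the square integrable variables known before time \<open>k\<close>, because
  \<open>\<bar>f\<bar>\<^sup>2\<close> can be pulled out of the conditional expectation \<open>\<E>[\<omega>\<^sub>k\<^sup>2 | \<F>\<^sub>k\<^sub>-\<^sub>1] = 1\<close>. This keeps the state square integrable
  although the noise is unbounded.
\<close>

lemma
  assumes k: "k < N" and f: "f \<in> L2_rv M (past M \<omega> k)"
  shows L2_rv_noise: "(\<lambda>z. \<omega> k z *\<^sub>R f z) \<in> L2_rv M (past M \<omega> (Suc k))"
    and integral_norm2_noise:
      "(\<integral>z. (norm (\<omega> k z *\<^sub>R f z))\<^sup>2 \<partial>M) = (\<integral>z. (norm (f z))\<^sup>2 \<partial>M)"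
proof -
  let ?F = "past M \<omega> k"
  have sub: "subalgebra M ?F"
    using k by (simp add: subalgebra_past)
  interpret F: finite_measure_subalgebra M ?F
    by unfold_locales (rule sub)
  have fF [measurable]: "f \<in> borel_measurable ?F"
    using f by (simp add: L2_rv_def)
  have [measurable]: "f \<in> borel_measurable M" "\<omega> k \<in> borel_measurable M"
    using measurable_from_subalg[OF sub fF] noise_measurable[OF k] by auto
  (* The real conditional expectation is the difference of those of the positive and the negative
     part. The latter vanishes, and the value 1 rules out an infinite positive part, since
     enn2real sends infinity to 0; so the nonnegative conditional expectation itself is 1. *)
  have "AE z in M. nn_cond_exp M ?F (\<lambda>z. ennreal (- (\<omega> k z)\<^sup>2)) z = 0"
    using F.nn_cond_exp_F_meas[of "\<lambda>z. 0"]
    by (auto simp: ennreal_neg elim!: eventually_mono)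
  moreover have "AE z in M. real_cond_exp M ?F (\<lambda>y. (\<omega> k y)\<^sup>2) z = 1"
    using noise k by (auto simp: noise_def)
  ultimately have one: "AE z in M. nn_cond_exp M ?F (\<lambda>y. ennreal ((\<omega> k y)\<^sup>2)) z = 1"
  proof eventually_elim
    case (elim z)
    then have "enn2real (nn_cond_exp M ?F (\<lambda>y. ennreal ((\<omega> k y)\<^sup>2)) z) = 1"
      by (simp add: real_cond_exp_def)
    then show ?case
      by (metis ennreal_1 ennreal_enn2real_if enn2real_top zero_neq_one)
  qed
  have "(\<integral>\<^sup>+z. ennreal ((norm (\<omega> k z *\<^sub>R f z))\<^sup>2) \<partial>M)
      = (\<integral>\<^sup>+z. ennreal ((norm (f z))\<^sup>2) * ennreal ((\<omega> k z)\<^sup>2) \<partial>M)"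
    by (simp add: power_mult_distrib ennreal_mult' mult.commute)
  also have "\<dots> = (\<integral>\<^sup>+z. ennreal ((norm (f z))\<^sup>2) * nn_cond_exp M ?F (\<lambda>y. ennreal ((\<omega> k y)\<^sup>2)) z \<partial>M)"
    by (rule F.nn_cond_exp_intg[symmetric]) auto
  also have "\<dots> = (\<integral>\<^sup>+z. ennreal ((norm (f z))\<^sup>2) \<partial>M)"
    by (rule nn_integral_cong_AE) (use one in \<open>eventually_elim, simp\<close>)
  finally have nn: "(\<integral>\<^sup>+z. ennreal ((norm (\<omega> k z *\<^sub>R f z))\<^sup>2) \<partial>M)
      = (\<integral>\<^sup>+z. ennreal ((norm (f z))\<^sup>2) \<partial>M)" .
  have "integrable M (\<lambda>z. (norm (\<omega> k z *\<^sub>R f z))\<^sup>2)"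
    using f nn by (simp add: L2_rv_def integrable_iff_bounded)
  moreover have "(\<lambda>z. \<omega> k z *\<^sub>R f z) \<in> borel_measurable (past M \<omega> (Suc k))"
    using noise_measurable_past[of k "Suc k"] measurable_from_subalg[OF past_mono[of k "Suc k"] fF] k
    by (intro borel_measurable_scaleR) auto
  ultimately show "(\<lambda>z. \<omega> k z *\<^sub>R f z) \<in> L2_rv M (past M \<omega> (Suc k))"
    by (simp add: L2_rv_def)
  show "(\<integral>z. (norm (\<omega> k z *\<^sub>R f z))\<^sup>2 \<partial>M) = (\<integral>z. (norm (f z))\<^sup>2 \<partial>M)"
    using nn by (subst (1 2) integral_eq_nn_integral) auto
qed

lemma L2_proc_iff:
  "f \<in> L2_proc M \<omega> {..<N} \<longleftrightarrow> (\<forall>k<N. f k \<in> L2_rv M (past M \<omega> k))"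
proof
  assume f: "f \<in> L2_proc M \<omega> {..<N}"
  show "\<forall>k<N. f k \<in> L2_rv M (past M \<omega> k)"
  proof (intro allI impI)
    fix k assume k: "k < N"
    have fk: "f k \<in> borel_measurable (past M \<omega> k)"
      using f k by (auto simp: L2_proc_def)
    have [measurable]: "f k \<in> borel_measurable M"
      using measurable_from_subalg[OF subalgebra_past fk] k by simp
    have "integrable M (\<lambda>z. (norm (f k z))\<^sup>2)"
    proof (rule Bochner_Integration.integrable_bound)
      show "integrable M (\<lambda>z. \<Sum>k<N. (norm (f k z))\<^sup>2)"
        using f by (simp add: L2_proc_def)
      show "AE z in M. norm ((norm (f k z))\<^sup>2) \<le> norm (\<Sum>k<N. (norm (f k z))\<^sup>2)"
        using k by (auto simp: sum_nonneg intro!: member_le_sum[of k "{..<N}" "\<lambda>k. (norm (f k _))\<^sup>2"])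
    qed simp
    then show "f k \<in> L2_rv M (past M \<omega> k)"
      using fk by (simp add: L2_rv_def)
  qed
qed (auto simp: L2_proc_def L2_rv_def)

lemma Linf_procD:
  "f \<in> Linf_proc M \<omega> {..<N} \<Longrightarrow> k < N \<Longrightarrow> f k \<in> Linf_rv M (past M \<omega> k)"
  by (auto simp: Linf_proc_def Linf_rv_def elim!: eventually_mono)

lemma L2_procD: "f \<in> L2_proc M \<omega> {..<N} \<Longrightarrow> k < N \<Longrightarrow> f k \<in> L2_rv M (past M \<omega> k)"
  by (simp add: L2_proc_iff)

lemma L2_proc_rv: "f \<in> L2_proc M \<omega> {..<N} \<Longrightarrow> k < N \<Longrightarrow> f k \<in> L2_rv M M"
  by (rule L2_rv_weaken[OF subalgebra_past L2_procD]) auto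

lemma Linf_proc_rv: "f \<in> Linf_proc M \<omega> {..<N} \<Longrightarrow> k < N \<Longrightarrow> f k \<in> Linf_rv M M"
  by (rule Linf_rv_weaken[OF subalgebra_past Linf_procD]) auto

end



section \<open>Functionals that are quadratic along lines\<close>

text \<open>
  The exact expansion makes every difference quotient affine in \<open>t\<close>, so that the derivative is its
  value at \<open>t = 0\<close>. Boundedness of \<open>\<Lambda>\<close> comes from the quadratic growth bound by homogeneity: normalise
  the direction if it has positive norm, and scale it up without limit if its norm is zero.
\<close>

lemma has_gateaux_derivative_if_quadratic:
  fixes J \<Lambda> :: "(nat \<Rightarrow> 'a \<Rightarrow> 'b::real_normed_vector) \<Rightarrow> real"
  assumes scale: "\<And>w r. w \<in> V \<Longrightarrow> (\<lambda>k z. r *\<^sub>R w k z) \<in> V"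
    and nrm_nonneg: "\<And>w. 0 \<le> nrm w"
    and nrm_scale: "\<And>w r. nrm (\<lambda>k z. r *\<^sub>R w k z) = \<bar>r\<bar> * nrm w"
    and lin: "\<And>w1 w2 a b. w1 \<in> V \<Longrightarrow> w2 \<in> V \<Longrightarrow>
      \<Lambda> (\<lambda>k z. a *\<^sub>R w1 k z + b *\<^sub>R w2 k z) = a * \<Lambda> w1 + b * \<Lambda> w2"
    and bound: "\<And>w. w \<in> V \<Longrightarrow> \<bar>\<Lambda> w\<bar> \<le> c * (1 + (nrm w)\<^sup>2)"
    and expand: "\<And>w t. w \<in> V \<Longrightarrow> J (\<lambda>k z. u k z + t *\<^sub>R w k z) = J u + t * \<Lambda> w + t\<^sup>2 * q w"
  shows "has_gateaux_derivative V nrm J \<Lambda> u"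
  unfolding has_gateaux_derivative_def
proof (intro conjI ballI allI)
  have hom: "\<Lambda> (\<lambda>k z. r *\<^sub>R w k z) = r * \<Lambda> w" if "w \<in> V" for r w
    using lin[OF that that, of r 0] by simp
  have le: "\<bar>r\<bar> * \<bar>\<Lambda> w\<bar> \<le> c * (1 + (\<bar>r\<bar> * nrm w)\<^sup>2)" if "w \<in> V" for r w
    using bound[OF scale[OF that, of r]] hom[OF that, of r] by (simp add: nrm_scale abs_mult)
  have "\<bar>\<Lambda> w\<bar> \<le> 2 * c * nrm w" if w: "w \<in> V" for w
  proof (cases "nrm w = 0")
    case True
    have "\<Lambda> w = 0"
    proof (rule ccontr)
      assume "\<Lambda> w \<noteq> 0"
      then show False
        (* scaled by this factor, the left-hand side of the bound exceeds c *)
        using le[OF w, of "(\<bar>c\<bar> + 1) / \<bar>\<Lambda> w\<bar>"] True by simp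
    qed
    then show ?thesis
      using True by simp
  next
    case False
    then have "nrm w > 0"
      using nrm_nonneg[of w] by simp
    then show ?thesis
      using le[OF w, of "1 / nrm w"] by (simp add: field_simps)
  qed
  then show "\<exists>K. \<forall>w\<in>V. \<bar>\<Lambda> w\<bar> \<le> K * nrm w"
    by blast
next
  fix w assume w: "w \<in> V"
  have "((\<lambda>t. \<Lambda> w + t * q w) \<longlongrightarrow> \<Lambda> w + 0 * q w) (at 0)"
    by (intro tendsto_intros)
  moreover have "\<forall>\<^sub>F t in at 0. \<Lambda> w + t * q w = (J (\<lambda>k z. u k z + t *\<^sub>R w k z) - J u) / t"
    using eventually_at_filter[of "\<lambda>t. t \<noteq> 0" "0::real"]
    by (auto simp: expand[OF w] field_simps power2_eq_square eventually_at_filter)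
  ultimately show "((\<lambda>t. (J (\<lambda>k z. u k z + t *\<^sub>R w k z) - J u) / t) \<longlongrightarrow> \<Lambda> w) (at 0)"
    by (simp add: tendsto_cong)
qed (rule lin)

lemma eq_INF_ereal_iff_minimal:
  assumes "u \<in> V"
  shows "ereal (J u) = (INF v\<in>V. ereal (J v)) \<longleftrightarrow> (\<forall>v\<in>V. J u \<le> J v)"
proof
  assume "ereal (J u) = (INF v\<in>V. ereal (J v))"
  then show "\<forall>v\<in>V. J u \<le> J v"
    by (metis INF_lower ereal_less_eq(3))
next
  assume "\<forall>v\<in>V. J u \<le> J v"
  then show "ereal (J u) = (INF v\<in>V. ereal (J v))"
    using assms by (intro antisym INF_greatest INF_lower) auto
qed

lemma linear_coefficient_zero:
  fixes a c :: real
  assumes "\<And>t. 0 \<le> t * a + t\<^sup>2 * c"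
  shows "a = 0"
proof -
  have prod: "0 \<le> t * (a + t * c)" for t
    using assms[of t] by (simp add: power2_eq_square algebra_simps)
  have "((\<lambda>t. a + t * c) \<longlongrightarrow> a + 0 * c) (at_right 0)" "((\<lambda>t. a + t * c) \<longlongrightarrow> a + 0 * c) (at_left 0)"
    by (intro tendsto_intros)+
  moreover have "\<forall>\<^sub>F t in at_right 0. 0 \<le> a + t * c"
    using prod zero_le_mult_iff[of _ "a + _ * c"]
    by (auto simp: eventually_at_filter intro!: always_eventually) (smt (verit))
  moreover have "\<forall>\<^sub>F t in at_left 0. a + t * c \<le> 0"
    using prod zero_le_mult_iff[of _ "a + _ * c"]
    by (auto simp: eventually_at_filter intro!: always_eventually) (smt (verit))
  ultimately show ?thesis
    using tendsto_lowerbound[of "\<lambda>t. a + t * c" "a + 0 * c" "at_right 0" 0]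
      tendsto_upperbound[of "\<lambda>t. a + t * c" "a + 0 * c" "at_left 0" 0] by simp
qed

text \<open>
  If \<open>u\<close> is minimal, then \<open>t \<Lambda> w + t\<^sup>2 q w \<ge> 0\<close> for every real \<open>t\<close>, which forces \<open>\<Lambda> w = 0\<close>. Conversely, if \<open>\<Lambda>\<close> vanishes,
  the expansion at \<open>t = 1\<close> in the direction \<open>v - u\<close> gives \<open>J v = J u + q (v - u) \<ge> J u\<close>.
\<close>

lemma minimal_iff_stationary_if_convex_quadratic:
  fixes J \<Lambda> :: "(nat \<Rightarrow> 'a \<Rightarrow> 'b::real_normed_vector) \<Rightarrow> real"
  assumes u: "u \<in> V"
    and comb: "\<And>w1 w2 r. w1 \<in> V \<Longrightarrow> w2 \<in> V \<Longrightarrow> (\<lambda>k z. w1 k z + r *\<^sub>R w2 k z) \<in> V"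
    and expand: "\<And>w t. w \<in> V \<Longrightarrow> J (\<lambda>k z. u k z + t *\<^sub>R w k z) = J u + t * \<Lambda> w + t\<^sup>2 * q w"
    and q: "\<And>w. w \<in> V \<Longrightarrow> 0 \<le> q w"
  shows "(\<forall>v\<in>V. J u \<le> J v) \<longleftrightarrow> (\<forall>w\<in>V. \<Lambda> w = 0)"
proof (intro iffI ballI)
  fix w assume min: "\<forall>v\<in>V. J u \<le> J v" and w: "w \<in> V"
  show "\<Lambda> w = 0"
    by (rule linear_coefficient_zero[where c = "q w"]) (use min comb[OF u w] expand[OF w] in \<open>smt (verit)\<close>)
next
  fix v assume stat: "\<forall>w\<in>V. \<Lambda> w = 0" and v: "v \<in> V"
  have w: "(\<lambda>k z. v k z + (- 1) *\<^sub>R u k z) \<in> V"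
    by (rule comb[OF v u])
  have "J v = J u + q (\<lambda>k z. v k z + (- 1) *\<^sub>R u k z)"
    using expand[OF w, of 1] stat w by simp
  then show "J u \<le> J v"
    using q[OF w] by simp
qed

section \<open>The state equation\<close>

text \<open>
  The two players enter the dynamics symmetrically, so that whatever is proved for the first one
  applies to the second.
\<close>

lemma state_swap:
  "state \<omega> A B C b D E F \<sigma> \<xi> u v = state \<omega> A C B b D F E \<sigma> \<xi> v u"
proof
  show "state \<omega> A B C b D E F \<sigma> \<xi> u v k = state \<omega> A C B b D F E \<sigma> \<xi> v u k" for k
    by (induction k) (simp_all add: algebra_simps)
qed

text \<open>
  The state equation without inhomogeneities, opponent and initial value: the change of the state
  per unit of control in the direction \<open>w\<close>.
\<close>

primrec response ::
    "(nat \<Rightarrow> 'a \<Rightarrow> real) \<Rightarrow> (nat \<Rightarrow> 'a \<Rightarrow> real^'n^'n) \<Rightarrow> (nat \<Rightarrow> 'a \<Rightarrow> real^'m^'n) \<Rightarrow>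
     (nat \<Rightarrow> 'a \<Rightarrow> real^'n^'n) \<Rightarrow> (nat \<Rightarrow> 'a \<Rightarrow> real^'m^'n) \<Rightarrow> (nat \<Rightarrow> 'a \<Rightarrow> real^'m) \<Rightarrow>
     nat \<Rightarrow> 'a \<Rightarrow> real^'n" where
  "response \<omega> A B D E w 0 = (\<lambda>z. 0)"
| "response \<omega> A B D E w (Suc k) = (\<lambda>z.
     (A k z *v response \<omega> A B D E w k z + B k z *v w k z) +
     \<omega> k z *\<^sub>R (D k z *v response \<omega> A B D E w k z + E k z *v w k z))"

lemma state_perturb:
  "state \<omega> A B C b D E F \<sigma> \<xi> (\<lambda>k z. u k z + t *\<^sub>R w k z) v k z
    = state \<omega> A B C b D E F \<sigma> \<xi> u v k z + t *\<^sub>R response \<omega> A B D E w k z"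
  by (induction k)
     (simp_all add: matrix_vector_right_distrib matrix_vector_mult_scaleR scaleR_add_right mult.commute
       add_ac)

lemma response_linear:
  "response \<omega> A B D E (\<lambda>k z. a *\<^sub>R w1 k z + c *\<^sub>R w2 k z) k z
    = a *\<^sub>R response \<omega> A B D E w1 k z + c *\<^sub>R response \<omega> A B D E w2 k z"
  by (induction k)
     (simp_all add: matrix_vector_right_distrib matrix_vector_mult_scaleR scaleR_add_right mult.commute
       add_ac)

lemma L2_norm_nonneg: "0 \<le> L2_norm M I f"
  by (simp add: L2_norm_def sum_nonneg)

lemma L2_norm_scaleR: "L2_norm M I (\<lambda>k z. r *\<^sub>R f k z) = \<bar>r\<bar> * L2_norm M I f"
  by (simp add: L2_norm_def power_mult_distrib real_sqrt_mult flip: sum_distrib_left)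

context noise_space
begin

lemma L2_rv_past_Suc: "k < N \<Longrightarrow> f \<in> L2_rv M (past M \<omega> k) \<Longrightarrow> f \<in> L2_rv M (past M \<omega> (Suc k))"
  by (rule L2_rv_mono[OF subalgebra_past past_mono]) auto

lemma L2_rv_const: "k \<le> N \<Longrightarrow> (\<lambda>z. c) \<in> L2_rv M (past M \<omega> k)"
  by (simp add: L2_rv_def)

lemma L2_proc_add_scaleR:
  assumes "f \<in> L2_proc M \<omega> {..<N}" "g \<in> L2_proc M \<omega> {..<N}"
  shows "(\<lambda>k z. f k z + r *\<^sub>R g k z) \<in> L2_proc M \<omega> {..<N}"
  using assms by (auto simp: L2_proc_iff intro!: L2_rv_add L2_rv_scaleR subalgebra_past)

lemma L2_proc_scaleR: "f \<in> L2_proc M \<omega> {..<N} \<Longrightarrow> (\<lambda>k z. r *\<^sub>R f k z) \<in> L2_proc M \<omega> {..<N}"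
  by (auto simp: L2_proc_iff intro!: L2_rv_scaleR)

lemma L2_norm_power2:
  assumes "f \<in> L2_proc M \<omega> {..<N}"
  shows "(L2_norm M {..<N} f)\<^sup>2 = (\<Sum>k<N. \<integral>z. (norm (f k z))\<^sup>2 \<partial>M)"
proof -
  have "(L2_norm M {..<N} f)\<^sup>2 = (\<integral>z. (\<Sum>k<N. (norm (f k z))\<^sup>2) \<partial>M)"
    by (simp add: L2_norm_def sum_nonneg)
  also have "\<dots> = (\<Sum>k<N. \<integral>z. (norm (f k z))\<^sup>2 \<partial>M)"
    using assms by (intro Bochner_Integration.integral_sum) (auto simp: L2_proc_iff L2_rv_def)
  finally show ?thesis .
qed

lemma integral_norm2_le_L2_norm:
  assumes "f \<in> L2_proc M \<omega> {..<N}" "k < N"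
  shows "(\<integral>z. (norm (f k z))\<^sup>2 \<partial>M) \<le> (L2_norm M {..<N} f)\<^sup>2"
  unfolding L2_norm_power2[OF assms(1)]
  using assms(2) by (intro member_le_sum) auto

text \<open>
  One step of the dynamics has the form drift plus noise times diffusion. Drift and diffusion are known
  beforehand, so the isometry applies to the second summand.
\<close>

lemma L2_rv_Suc:
  assumes k: "k < N" and f: "f \<in> L2_rv M (past M \<omega> k)" and g: "g \<in> L2_rv M (past M \<omega> k)"
  shows "(\<lambda>z. f z + \<omega> k z *\<^sub>R g z) \<in> L2_rv M (past M \<omega> (Suc k))"
  using k L2_rv_past_Suc[OF k f] L2_rv_noise[OF k g] by (intro L2_rv_add subalgebra_past) auto

lemma integral_norm2_Suc_le:
  assumes k: "k < N" and f: "f \<in> L2_rv M (past M \<omega> k)" and g: "g \<in> L2_rv M (past M \<omega> k)"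
  shows "(\<integral>z. (norm (f z + \<omega> k z *\<^sub>R g z))\<^sup>2 \<partial>M)
    \<le> 2 * (\<integral>z. (norm (f z))\<^sup>2 \<partial>M) + 2 * (\<integral>z. (norm (g z))\<^sup>2 \<partial>M)"
  using integral_norm2_add_le[OF subalgebra_past L2_rv_past_Suc[OF k f] L2_rv_noise[OF k g]] k
  by (simp only: integral_norm2_noise[OF k g] Suc_le_eq)

lemma state_L2:
  assumes "A \<in> Linf_proc M \<omega> {..<N}" "B \<in> Linf_proc M \<omega> {..<N}" "C \<in> Linf_proc M \<omega> {..<N}"
    and "b \<in> L2_proc M \<omega> {..<N}"
    and "D \<in> Linf_proc M \<omega> {..<N}" "E \<in> Linf_proc M \<omega> {..<N}" "F \<in> Linf_proc M \<omega> {..<N}"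
    and "\<sigma> \<in> L2_proc M \<omega> {..<N}"
    and "u \<in> L2_proc M \<omega> {..<N}" "v \<in> L2_proc M \<omega> {..<N}" and "k \<le> N"
  shows "state \<omega> A B C b D E F \<sigma> \<xi> u v k \<in> L2_rv M (past M \<omega> k)"
  using \<open>k \<le> N\<close>
proof (induction k)
  case (Suc k)
  then have k: "k < N" "k \<le> N"
    by auto
  show ?case
    unfolding state.simps
    by (intro L2_rv_Suc[OF k(1)] L2_rv_add L2_rv_matrix_mult subalgebra_past[OF k(2)] Suc.IH[OF k(2)]
        Linf_procD[OF _ k(1)] assms L2_procD[OF _ k(1)])
qed (simp add: L2_rv_const)

lemma response_L2:
  assumes "A \<in> Linf_proc M \<omega> {..<N}" "B \<in> Linf_proc M \<omega> {..<N}"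
    and "D \<in> Linf_proc M \<omega> {..<N}" "E \<in> Linf_proc M \<omega> {..<N}"
    and "w \<in> L2_proc M \<omega> {..<N}" and "k \<le> N"
  shows "response \<omega> A B D E w k \<in> L2_rv M (past M \<omega> k)"
  using \<open>k \<le> N\<close>
proof (induction k)
  case (Suc k)
  then have k: "k < N" "k \<le> N"
    by auto
  show ?case
    unfolding response.simps
    by (intro L2_rv_Suc[OF k(1)] L2_rv_add L2_rv_matrix_mult subalgebra_past[OF k(2)] Suc.IH[OF k(2)]
        Linf_procD[OF _ k(1)] assms L2_procD[OF _ k(1)])
qed (simp add: L2_rv_const)

lemma integral_norm2_matrix_mult_bound:
  fixes A :: "nat \<Rightarrow> 'a \<Rightarrow> real^'n^'m"
  assumes "A \<in> Linf_proc M \<omega> {..<N}" and k: "k < N"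
  obtains c where "c \<ge> 0" and "\<And>f. f \<in> L2_rv M (past M \<omega> k) \<Longrightarrow>
    (\<integral>z. (norm (A k z *v f z))\<^sup>2 \<partial>M) \<le> c * (\<integral>z. (norm (f z))\<^sup>2 \<partial>M)"
proof -
  obtain K where K: "AE z in M. norm (A k z) \<le> K" and A: "A k \<in> borel_measurable (past M \<omega> k)"
    using Linf_procD[OF assms] by (auto simp: Linf_rv_def)
  show ?thesis
    by (rule that[of "K\<^sup>2"]) (use integral_norm2_matrix_mult_le[OF subalgebra_past A K] k in auto)
qed

text \<open>
  By induction along the dynamics: each step applies essentially bounded matrices and the
  isometric noise. The constant depends on \<open>k\<close> but not on \<open>w\<close>, as boundedness of the derivative requires.
\<close>

lemma response_bounded:
  fixes B E :: "nat \<Rightarrow> 'a \<Rightarrow> real^'m^'n"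
  assumes A: "A \<in> Linf_proc M \<omega> {..<N}" and B: "B \<in> Linf_proc M \<omega> {..<N}"
    and D: "D \<in> Linf_proc M \<omega> {..<N}" and E: "E \<in> Linf_proc M \<omega> {..<N}" and "k \<le> N"
  shows "\<exists>K. \<forall>w \<in> L2_proc M \<omega> {..<N}.
    (\<integral>z. (norm (response \<omega> A B D E w k z))\<^sup>2 \<partial>M) \<le> K * (L2_norm M {..<N} w)\<^sup>2"
  using \<open>k \<le> N\<close>
proof (induction k)
  case 0
  show ?case
    by (auto intro!: exI[of _ 0])
next
  case (Suc k)
  then have k: "k < N" "k \<le> N"
    by auto
  let ?n = "\<lambda>w. (L2_norm M {..<N} w)\<^sup>2"
  obtain K where K: "\<And>w. w \<in> L2_proc M \<omega> {..<N} \<Longrightarrow>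
      (\<integral>z. (norm (response \<omega> A B D E w k z))\<^sup>2 \<partial>M) \<le> K * ?n w"
    using Suc.IH k by blast
  obtain cA where cA: "cA \<ge> 0" "\<And>f. f \<in> L2_rv M (past M \<omega> k) \<Longrightarrow>
      (\<integral>z. (norm (A k z *v f z))\<^sup>2 \<partial>M) \<le> cA * (\<integral>z. (norm (f z))\<^sup>2 \<partial>M)"
    using integral_norm2_matrix_mult_bound[OF A k(1)] by blast
  obtain cB where cB: "cB \<ge> 0" "\<And>f. f \<in> L2_rv M (past M \<omega> k) \<Longrightarrow>
      (\<integral>z. (norm (B k z *v f z))\<^sup>2 \<partial>M) \<le> cB * (\<integral>z. (norm (f z))\<^sup>2 \<partial>M)"
    using integral_norm2_matrix_mult_bound[OF B k(1)] by blast
  obtain cD where cD: "cD \<ge> 0" "\<And>f. f \<in> L2_rv M (past M \<omega> k) \<Longrightarrow>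
      (\<integral>z. (norm (D k z *v f z))\<^sup>2 \<partial>M) \<le> cD * (\<integral>z. (norm (f z))\<^sup>2 \<partial>M)"
    using integral_norm2_matrix_mult_bound[OF D k(1)] by blast
  obtain cE where cE: "cE \<ge> 0" "\<And>f. f \<in> L2_rv M (past M \<omega> k) \<Longrightarrow>
      (\<integral>z. (norm (E k z *v f z))\<^sup>2 \<partial>M) \<le> cE * (\<integral>z. (norm (f z))\<^sup>2 \<partial>M)"
    using integral_norm2_matrix_mult_bound[OF E k(1)] by blast
  show ?case
  proof (intro exI[of _ "4 * ((cA + cD) * K + (cB + cE))"] ballI)
    fix w :: "nat \<Rightarrow> 'a \<Rightarrow> real^'m"
    assume w: "w \<in> L2_proc M \<omega> {..<N}"
    let ?y = "response \<omega> A B D E w k"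
    note sub = subalgebra_past[OF k(2)]
    have y: "?y \<in> L2_rv M (past M \<omega> k)"
      by (rule response_L2[OF A B D E w k(2)])
    have wk: "w k \<in> L2_rv M (past M \<omega> k)"
      by (rule L2_procD[OF w k(1)])
    note mult = L2_rv_matrix_mult[OF sub Linf_procD[OF _ k(1)]]
    note Ay = mult[OF A y] and Bw = mult[OF B wk] and Dy = mult[OF D y] and Ew = mult[OF E wk]
    have yK: "c * (\<integral>z. (norm (?y z))\<^sup>2 \<partial>M) \<le> c * (K * ?n w)" if "c \<ge> 0" for c
      using K[OF w] that by (rule mult_left_mono)
    have wK: "c * (\<integral>z. (norm (w k z))\<^sup>2 \<partial>M) \<le> c * ?n w" if "c \<ge> 0" for c
      using integral_norm2_le_L2_norm[OF w k(1)] that by (rule mult_left_mono)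
    have "(\<integral>z. (norm (response \<omega> A B D E w (Suc k) z))\<^sup>2 \<partial>M)
        \<le> 2 * (\<integral>z. (norm (A k z *v ?y z + B k z *v w k z))\<^sup>2 \<partial>M)
          + 2 * (\<integral>z. (norm (D k z *v ?y z + E k z *v w k z))\<^sup>2 \<partial>M)"
      unfolding response.simps
      by (rule integral_norm2_Suc_le[OF k(1) L2_rv_add[OF sub Ay Bw] L2_rv_add[OF sub Dy Ew]])
    also have "\<dots> \<le> 4 * (cA * (K * ?n w) + cB * ?n w + cD * (K * ?n w) + cE * ?n w)"
      using integral_norm2_add_le[OF sub Ay Bw] integral_norm2_add_le[OF sub Dy Ew]
        order_trans[OF cA(2)[OF y] yK[OF cA(1)]] order_trans[OF cB(2)[OF wk] wK[OF cB(1)]]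
        order_trans[OF cD(2)[OF y] yK[OF cD(1)]] order_trans[OF cE(2)[OF wk] wK[OF cE(1)]]
      by (smt (verit))
    also have "\<dots> = 4 * ((cA + cD) * K + (cB + cE)) * ?n w"
      by (simp add: algebra_simps)
    finally show "(\<integral>z. (norm (response \<omega> A B D E w (Suc k) z))\<^sup>2 \<partial>M)
        \<le> 4 * ((cA + cD) * K + (cB + cE)) * ?n w" .
  qed
qed

end



section \<open>Variations of the quadratic cost\<close>

text \<open>
  The gradient of one half of the cost integrand at \<open>(x, u)\<close> paired with \<open>(y, w)\<close>. The two mixed terms of each quadratic
  form are merged into one, which is legitimate when \<open>G\<close>, \<open>Q\<close>, \<open>R\<close> are symmetric.
\<close>

definition first_variation ::
    "'a measure \<Rightarrow> nat \<Rightarrow> ('a \<Rightarrow> real^'n^'n) \<Rightarrow> ('a \<Rightarrow> real^'n) \<Rightarrow>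
     (nat \<Rightarrow> 'a \<Rightarrow> real^'n^'n) \<Rightarrow> (nat \<Rightarrow> 'a \<Rightarrow> real^'n^'m) \<Rightarrow> (nat \<Rightarrow> 'a \<Rightarrow> real^'m^'m) \<Rightarrow>
     (nat \<Rightarrow> 'a \<Rightarrow> real^'n) \<Rightarrow> (nat \<Rightarrow> 'a \<Rightarrow> real^'m) \<Rightarrow>
     (nat \<Rightarrow> 'a \<Rightarrow> real^'n) \<Rightarrow> (nat \<Rightarrow> 'a \<Rightarrow> real^'m) \<Rightarrow>
     (nat \<Rightarrow> 'a \<Rightarrow> real^'n) \<Rightarrow> (nat \<Rightarrow> 'a \<Rightarrow> real^'m) \<Rightarrow> real" where
  "first_variation M N G g Q L R q \<rho> x u y w =
    (\<integral>z. ((G z *v x N z + g z) \<bullet> y N z +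
      (\<Sum>k<N. (Q k z *v x k z + transpose (L k z) *v u k z + q k z) \<bullet> y k z +
              (L k z *v x k z + R k z *v u k z + \<rho> k z) \<bullet> w k z)) \<partial>M)"

text \<open>
  Adaptedness matters for the state equation only; the cost needs no more than measurability with
  respect to \<open>M\<close>.
\<close>

locale cost_data =
  fixes M :: "'a measure" and N :: nat
    and G :: "'a \<Rightarrow> real^'n^'n" and g :: "'a \<Rightarrow> real^'n" and Q :: "nat \<Rightarrow> 'a \<Rightarrow> real^'n^'n"
    and L :: "nat \<Rightarrow> 'a \<Rightarrow> real^'n^'m" and R :: "nat \<Rightarrow> 'a \<Rightarrow> real^'m^'m"
    and q :: "nat \<Rightarrow> 'a \<Rightarrow> real^'n" and \<rho> :: "nat \<Rightarrow> 'a \<Rightarrow> real^'m"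
  assumes G: "G \<in> Linf_rv M M" and g: "g \<in> L2_rv M M"
    and Q: "\<And>k. k < N \<Longrightarrow> Q k \<in> Linf_rv M M"
    and L: "\<And>k. k < N \<Longrightarrow> L k \<in> Linf_rv M M"
    and R: "\<And>k. k < N \<Longrightarrow> R k \<in> Linf_rv M M"
    and q: "\<And>k. k < N \<Longrightarrow> q k \<in> L2_rv M M"
    and \<rho>: "\<And>k. k < N \<Longrightarrow> \<rho> k \<in> L2_rv M M"
begin

definition "L2_pair x u \<longleftrightarrow> (\<forall>k\<le>N. x k \<in> L2_rv M M) \<and> (\<forall>k<N. u k \<in> L2_rv M M)"
  for x :: "nat \<Rightarrow> 'a \<Rightarrow> real^'n" and u :: "nat \<Rightarrow> 'a \<Rightarrow> real^'m"

lemma L2_pairD: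
  assumes "L2_pair x u"
  shows "x N \<in> L2_rv M M" "k < N \<Longrightarrow> x k \<in> L2_rv M M" "k < N \<Longrightarrow> u k \<in> L2_rv M M"
  using assms by (auto simp: L2_pair_def)

lemmas L2_intros = L2_rv_add[OF subalgebra_refl] L2_rv_matrix_mult[OF subalgebra_refl]
  Linf_rv_transpose

lemma integrable_cost:
  assumes xu: "L2_pair x u"
  shows "integrable M (\<lambda>z. (G z *v x N z) \<bullet> x N z + 2 * (g z \<bullet> x N z) +
      (\<Sum>k<N. (Q k z *v x k z) \<bullet> x k z + 2 * ((transpose (L k z) *v u k z) \<bullet> x k z) +
              (R k z *v u k z) \<bullet> u k z + 2 * (q k z \<bullet> x k z) + 2 * (\<rho> k z \<bullet> u k z)))"
  by (intro Bochner_Integration.integrable_add Bochner_Integration.integrable_sum integrable_mult_right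
      integrable_inner_L2 L2_intros G g Q L R q \<rho> L2_pairD[OF xu]) auto

lemma gradient_L2:
  assumes xu: "L2_pair x u"
  shows "(\<lambda>z. G z *v x N z + g z) \<in> L2_rv M M"
    and "k < N \<Longrightarrow> (\<lambda>z. Q k z *v x k z + transpose (L k z) *v u k z + q k z) \<in> L2_rv M M"
    and "k < N \<Longrightarrow> (\<lambda>z. L k z *v x k z + R k z *v u k z + \<rho> k z) \<in> L2_rv M M"
  by (intro L2_intros G g Q L R q \<rho> L2_pairD[OF xu]; assumption)+

lemma integrable_first_variation_terms:
  assumes xu: "L2_pair x u" and yw: "L2_pair y w"
  shows "integrable M (\<lambda>z. (G z *v x N z + g z) \<bullet> y N z)"
    and "k < N \<Longrightarrow> integrable M (\<lambda>z. (Q k z *v x k z + transpose (L k z) *v u k z + q k z) \<bullet> y k z)"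
    and "k < N \<Longrightarrow> integrable M (\<lambda>z. (L k z *v x k z + R k z *v u k z + \<rho> k z) \<bullet> w k z)"
  by (intro integrable_inner_L2 gradient_L2[OF xu] L2_pairD[OF yw]; assumption)+

lemma integrable_first_variation:
  assumes xu: "L2_pair x u" and yw: "L2_pair y w"
  shows "integrable M (\<lambda>z. (G z *v x N z + g z) \<bullet> y N z +
      (\<Sum>k<N. (Q k z *v x k z + transpose (L k z) *v u k z + q k z) \<bullet> y k z +
              (L k z *v x k z + R k z *v u k z + \<rho> k z) \<bullet> w k z))"
  by (intro Bochner_Integration.integrable_add Bochner_Integration.integrable_sum
      integrable_first_variation_terms[OF xu yw]) auto

lemma first_variation_linear:
  assumes xu: "L2_pair x u" and yw1: "L2_pair y1 w1" and yw2: "L2_pair y2 w2"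
  shows "first_variation M N G g Q L R q \<rho> x u
      (\<lambda>k z. a *\<^sub>R y1 k z + c *\<^sub>R y2 k z) (\<lambda>k z. a *\<^sub>R w1 k z + c *\<^sub>R w2 k z)
    = a * first_variation M N G g Q L R q \<rho> x u y1 w1 + c * first_variation M N G g Q L R q \<rho> x u y2 w2"
proof -
  note int = integrable_first_variation[OF xu yw1, THEN integrable_mult_right, of a]
    integrable_first_variation[OF xu yw2, THEN integrable_mult_right, of c]
  show ?thesis
    unfolding first_variation_def integral_mult_right_zero[symmetric]
      Bochner_Integration.integral_add[OF int, symmetric]
    by (rule Bochner_Integration.integral_cong)
       (simp_all only: inner_add_right inner_scaleR_right sum.distrib sum_distrib_left distrib_left add_ac)
qed

lemma first_variation_bound:
  assumes xu: "L2_pair x u"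
  obtains c where "\<And>y w. L2_pair y w \<Longrightarrow> \<bar>first_variation M N G g Q L R q \<rho> x u y w\<bar>
    \<le> c + (\<integral>z. (norm (y N z))\<^sup>2 \<partial>M) +
      (\<Sum>k<N. (\<integral>z. (norm (y k z))\<^sup>2 \<partial>M) + (\<integral>z. (norm (w k z))\<^sup>2 \<partial>M))"
proof
  fix y w assume yw: "L2_pair y w"
  let ?p = "\<lambda>z. G z *v x N z + g z"
  let ?r = "\<lambda>k z. Q k z *v x k z + transpose (L k z) *v u k z + q k z"
  let ?s = "\<lambda>k z. L k z *v x k z + R k z *v u k z + \<rho> k z"
  let ?ms = "\<lambda>f. \<integral>z. (norm (f z))\<^sup>2 \<partial>M"
  note int = integrable_first_variation_terms[OF xu yw]
  have "first_variation M N G g Q L R q \<rho> x u y w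
      = (\<integral>z. ?p z \<bullet> y N z \<partial>M) + (\<integral>z. (\<Sum>k<N. ?r k z \<bullet> y k z + ?s k z \<bullet> w k z) \<partial>M)"
    unfolding first_variation_def
    by (intro Bochner_Integration.integral_add Bochner_Integration.integrable_sum
        Bochner_Integration.integrable_add int) auto
  also have "(\<integral>z. (\<Sum>k<N. ?r k z \<bullet> y k z + ?s k z \<bullet> w k z) \<partial>M)
      = (\<Sum>k<N. \<integral>z. ?r k z \<bullet> y k z + ?s k z \<bullet> w k z \<partial>M)"
    by (intro Bochner_Integration.integral_sum Bochner_Integration.integrable_add int) auto
  also have "\<dots> = (\<Sum>k<N. (\<integral>z. ?r k z \<bullet> y k z \<partial>M) + (\<integral>z. ?s k z \<bullet> w k z \<partial>M))"
    by (intro sum.cong refl Bochner_Integration.integral_add int) auto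
  finally have eq: "first_variation M N G g Q L R q \<rho> x u y w
      = (\<integral>z. ?p z \<bullet> y N z \<partial>M) + (\<Sum>k<N. (\<integral>z. ?r k z \<bullet> y k z \<partial>M) + (\<integral>z. ?s k z \<bullet> w k z \<partial>M))" .
  have "\<bar>first_variation M N G g Q L R q \<rho> x u y w\<bar> \<le> \<bar>\<integral>z. ?p z \<bullet> y N z \<partial>M\<bar>
      + (\<Sum>k<N. \<bar>\<integral>z. ?r k z \<bullet> y k z \<partial>M\<bar> + \<bar>\<integral>z. ?s k z \<bullet> w k z \<partial>M\<bar>)"
    unfolding eq
    by (intro order_trans[OF abs_triangle_ineq] add_mono order_refl order_trans[OF sum_abs] sum_mono
        abs_triangle_ineq)
  also have "\<dots> \<le> (?ms ?p + ?ms (y N)) + (\<Sum>k<N. (?ms (?r k) + ?ms (y k)) + (?ms (?s k) + ?ms (w k)))"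
    by (intro add_mono sum_mono integral_inner_L2_le gradient_L2[OF xu] L2_pairD[OF yw]) auto
  also have "\<dots> = (?ms ?p + (\<Sum>k<N. ?ms (?r k) + ?ms (?s k))) + ?ms (y N) + (\<Sum>k<N. ?ms (y k) + ?ms (w k))"
    by (simp add: sum.distrib add_ac)
  finally show "\<bar>first_variation M N G g Q L R q \<rho> x u y w\<bar>
      \<le> (?ms ?p + (\<Sum>k<N. ?ms (?r k) + ?ms (?s k))) + ?ms (y N) + (\<Sum>k<N. ?ms (y k) + ?ms (w k))" .
qed

end

text \<open>
  The next three lemmas expand the integrand of the cost at one point of the sample space. Symmetry makes the two
  mixed terms of a quadratic form equal.
\<close>

lemma quadratic_form_perturb:
  fixes Q :: "real^'n^'n"
  assumes "transpose Q = Q"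
  shows "(Q *v (x + t *\<^sub>R y)) \<bullet> (x + t *\<^sub>R y)
    = (Q *v x) \<bullet> x + t * (2 * ((Q *v x) \<bullet> y)) + t\<^sup>2 * ((Q *v y) \<bullet> y)"
proof -
  have "(Q *v y) \<bullet> x = (Q *v x) \<bullet> y"
    using inner_transpose_mult[of Q y x] assms by (simp add: inner_commute)
  then show ?thesis
    by (simp add: matrix_vector_right_distrib matrix_vector_mult_scaleR inner_add power2_eq_square
        algebra_simps)
qed

lemma cross_term_perturb:
  fixes L :: "real^'n^'m"
  shows "(transpose L *v (u + t *\<^sub>R w)) \<bullet> (x + t *\<^sub>R y)
    = (transpose L *v u) \<bullet> x + t * ((transpose L *v u) \<bullet> y + (L *v x) \<bullet> w)
      + t\<^sup>2 * ((transpose L *v w) \<bullet> y)"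
  unfolding inner_transpose_mult
  by (simp add: matrix_vector_right_distrib matrix_vector_mult_scaleR inner_add power2_eq_square
      algebra_simps inner_commute)

lemma running_cost_perturb:
  fixes Q :: "real^'n^'n" and L :: "real^'n^'m" and R :: "real^'m^'m"
  assumes "transpose Q = Q" and "transpose R = R"
  shows "(Q *v (x + t *\<^sub>R y)) \<bullet> (x + t *\<^sub>R y) + 2 * ((transpose L *v (u + t *\<^sub>R w)) \<bullet> (x + t *\<^sub>R y))
      + (R *v (u + t *\<^sub>R w)) \<bullet> (u + t *\<^sub>R w) + 2 * (q \<bullet> (x + t *\<^sub>R y)) + 2 * (\<rho> \<bullet> (u + t *\<^sub>R w))
    = ((Q *v x) \<bullet> x + 2 * ((transpose L *v u) \<bullet> x) + (R *v u) \<bullet> u + 2 * (q \<bullet> x) + 2 * (\<rho> \<bullet> u))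
      + t * (2 * ((Q *v x + transpose L *v u + q) \<bullet> y + (L *v x + R *v u + \<rho>) \<bullet> w))
      + t\<^sup>2 * ((Q *v y) \<bullet> y + 2 * ((transpose L *v w) \<bullet> y) + (R *v w) \<bullet> w)"
  unfolding quadratic_form_perturb[OF assms(1)] quadratic_form_perturb[OF assms(2)] cross_term_perturb
  unfolding inner_add inner_scaleR_right
  by algebra

lemma sum_quadratic_in_parameter:
  fixes f a v s :: "nat \<Rightarrow> real"
  assumes "\<And>k. k < N \<Longrightarrow> f k = a k + t * (2 * v k) + t\<^sup>2 * s k"
  shows "(\<Sum>k<N. f k) = (\<Sum>k<N. a k) + t * (2 * (\<Sum>k<N. v k)) + t\<^sup>2 * (\<Sum>k<N. s k)"
  using assms by (simp add: sum.distrib sum_distrib_left)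

lemma integral_quadratic_in_parameter:
  fixes a v s :: "'a \<Rightarrow> real"
  assumes "integrable M a" "integrable M v" "integrable M s"
  shows "(\<integral>z. a z + t * (2 * v z) + t\<^sup>2 * s z \<partial>M)
    = (\<integral>z. a z \<partial>M) + t * (2 * (\<integral>z. v z \<partial>M)) + t\<^sup>2 * (\<integral>z. s z \<partial>M)"
  using assms by simp

context cost_data
begin

text \<open>
  The second-order coefficient is again a quadratic cost, with the linear terms removed.
\<close>

lemma quadratic_cost_perturb:
  assumes xu: "L2_pair x u" and yw: "L2_pair y w"
    and sym: "AE z in M. transpose (G z) = G z \<and>
      (\<forall>k<N. transpose (Q k z) = Q k z \<and> transpose (R k z) = R k z)"
  shows "quadratic_cost M N G g Q L R q \<rho> (\<lambda>k z. x k z + t *\<^sub>R y k z) (\<lambda>k z. u k z + t *\<^sub>R w k z)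
    = quadratic_cost M N G g Q L R q \<rho> x u + t * first_variation M N G g Q L R q \<rho> x u y w
      + t\<^sup>2 * quadratic_cost M N G (\<lambda>_. 0) Q L R (\<lambda>_ _. 0) (\<lambda>_ _. 0) y w"
proof -
  interpret hom: cost_data M N G "\<lambda>_. 0" Q L R "\<lambda>_ _. 0" "\<lambda>_ _. 0"
    by unfold_locales (use G Q L R in auto)
  have yw': "hom.L2_pair y w"
    using yw by (simp add: L2_pair_def hom.L2_pair_def)
  have xyuw: "L2_pair (\<lambda>k z. x k z + t *\<^sub>R y k z) (\<lambda>k z. u k z + t *\<^sub>R w k z)"
    using xu yw unfolding L2_pair_def by (intro conjI allI impI L2_intros L2_rv_scaleR) auto
  let ?J = "\<lambda>x u z. (G z *v x N z) \<bullet> x N z + 2 * (g z \<bullet> x N z) +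
      (\<Sum>k<N. (Q k z *v x k z) \<bullet> x k z + 2 * ((transpose (L k z) *v u k z) \<bullet> x k z) +
              (R k z *v u k z) \<bullet> u k z + 2 * (q k z \<bullet> x k z) + 2 * (\<rho> k z \<bullet> u k z))"
  let ?V = "\<lambda>z. (G z *v x N z + g z) \<bullet> y N z +
      (\<Sum>k<N. (Q k z *v x k z + transpose (L k z) *v u k z + q k z) \<bullet> y k z +
              (L k z *v x k z + R k z *v u k z + \<rho> k z) \<bullet> w k z)"
  let ?S = "\<lambda>z. (G z *v y N z) \<bullet> y N z + 2 * (0 \<bullet> y N z) +
      (\<Sum>k<N. (Q k z *v y k z) \<bullet> y k z + 2 * ((transpose (L k z) *v w k z) \<bullet> y k z) +
              (R k z *v w k z) \<bullet> w k z + 2 * (0 \<bullet> y k z) + 2 * (0 \<bullet> w k z))"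
  note int = integrable_cost[OF xu] integrable_first_variation[OF xu yw] hom.integrable_cost[OF yw']
  have "(\<integral>z. ?J (\<lambda>k z. x k z + t *\<^sub>R y k z) (\<lambda>k z. u k z + t *\<^sub>R w k z) z \<partial>M)
      = (\<integral>z. ?J x u z + t * (2 * ?V z) + t\<^sup>2 * ?S z \<partial>M)"
  proof (rule integral_cong_AE)
    show "AE z in M. ?J (\<lambda>k z. x k z + t *\<^sub>R y k z) (\<lambda>k z. u k z + t *\<^sub>R w k z) z
        = ?J x u z + t * (2 * ?V z) + t\<^sup>2 * ?S z"
      using sym
    proof eventually_elim
      case (elim z)
      have run: "(\<Sum>k<N. (Q k z *v (x k z + t *\<^sub>R y k z)) \<bullet> (x k z + t *\<^sub>R y k z)
          + 2 * ((transpose (L k z) *v (u k z + t *\<^sub>R w k z)) \<bullet> (x k z + t *\<^sub>R y k z))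
          + (R k z *v (u k z + t *\<^sub>R w k z)) \<bullet> (u k z + t *\<^sub>R w k z)
          + 2 * (q k z \<bullet> (x k z + t *\<^sub>R y k z)) + 2 * (\<rho> k z \<bullet> (u k z + t *\<^sub>R w k z)))
        = (\<Sum>k<N. (Q k z *v x k z) \<bullet> x k z + 2 * ((transpose (L k z) *v u k z) \<bullet> x k z)
            + (R k z *v u k z) \<bullet> u k z + 2 * (q k z \<bullet> x k z) + 2 * (\<rho> k z \<bullet> u k z))
          + t * (2 * (\<Sum>k<N. (Q k z *v x k z + transpose (L k z) *v u k z + q k z) \<bullet> y k z
              + (L k z *v x k z + R k z *v u k z + \<rho> k z) \<bullet> w k z))
          + t\<^sup>2 * (\<Sum>k<N. (Q k z *v y k z) \<bullet> y k z + 2 * ((transpose (L k z) *v w k z) \<bullet> y k z)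
              + (R k z *v w k z) \<bullet> w k z)"
        by (rule sum_quadratic_in_parameter, rule running_cost_perturb) (use elim in auto)
      have final: "(G z *v (x N z + t *\<^sub>R y N z)) \<bullet> (x N z + t *\<^sub>R y N z) + 2 * (g z \<bullet> (x N z + t *\<^sub>R y N z))
        = ((G z *v x N z) \<bullet> x N z + 2 * (g z \<bullet> x N z)) + t * (2 * ((G z *v x N z + g z) \<bullet> y N z))
          + t\<^sup>2 * ((G z *v y N z) \<bullet> y N z)"
        unfolding quadratic_form_perturb[OF conjunct1[OF elim]]
        unfolding inner_add inner_scaleR_right
        by algebra
      show ?case
        unfolding final run inner_zero_left mult_zero_right add_0_right
        by algebra
    qed
    show "?J (\<lambda>k z. x k z + t *\<^sub>R y k z) (\<lambda>k z. u k z + t *\<^sub>R w k z) \<in> borel_measurable M"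
      by (rule borel_measurable_integrable[OF integrable_cost[OF xyuw]])
    show "(\<lambda>z. ?J x u z + t * (2 * ?V z) + t\<^sup>2 * ?S z) \<in> borel_measurable M"
      by (rule borel_measurable_integrable)
         (intro Bochner_Integration.integrable_add integrable_mult_right int)
  qed
  also have "\<dots> = (\<integral>z. ?J x u z \<partial>M) + t * (2 * (\<integral>z. ?V z \<partial>M)) + t\<^sup>2 * (\<integral>z. ?S z \<partial>M)"
    by (rule integral_quadratic_in_parameter[OF int])
  finally show ?thesis
    unfolding quadratic_cost_def first_variation_def by (simp only: distrib_left)
qed

end

lemma quadratic_cost_nonneg:
  assumes "\<delta> > 0"
    and sym: "AE z in M. \<forall>k<N. transpose (R k z) = R k z"
    and psd: "AE z in M. psd (G z) \<and> (\<forall>k<N. psd (R k z - \<delta> *\<^sub>R mat 1) \<and>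
      psd (Q k z - transpose (L k z) ** matrix_inv (R k z) ** L k z))"
  shows "0 \<le> quadratic_cost M N G (\<lambda>_. 0) Q L R (\<lambda>_ _. 0) (\<lambda>_ _. 0) y w"
proof -
  have "AE z in M. 0 \<le> (G z *v y N z) \<bullet> y N z +
      (\<Sum>k<N. (Q k z *v y k z) \<bullet> y k z + 2 * ((transpose (L k z) *v w k z) \<bullet> y k z) +
        (R k z *v w k z) \<bullet> w k z)"
    using sym psd
  proof eventually_elim
    case (elim z)
    have "0 \<le> (Q k z *v y k z) \<bullet> y k z + 2 * ((transpose (L k z) *v w k z) \<bullet> y k z)
        + (R k z *v w k z) \<bullet> w k z" if "k < N" for k
      by (rule complete_square[OF assms(1)]) (use elim that in auto)
    then show ?case
      using elim by (intro add_nonneg_nonneg[of "_ \<bullet> _" "sum _ _"] sum_nonneg)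
        (auto simp: psd_def[of "G z"] simp del: transpose_matrix_vector)
  qed
  then show ?thesis
    unfolding quadratic_cost_def
    by (intro mult_nonneg_nonneg integral_nonneg_AE) (simp_all del: transpose_matrix_vector)
qed

section \<open>One player against a fixed opponent\<close>

text \<open>
  The opponent's control \<open>v\<close> is fixed, so that what remains is an optimal control problem. Since
  the control and the opponent occur in the same way in the state equation, both players of the game
  are instances of this locale.
\<close>

locale lq_player = noise_space M N \<omega>
  for M :: "'a measure" and N :: nat and \<omega> :: "nat \<Rightarrow> 'a \<Rightarrow> real" +
  fixes A D Q :: "nat \<Rightarrow> 'a \<Rightarrow> real^'n^'n"
    and B E :: "nat \<Rightarrow> 'a \<Rightarrow> real^'m^'n" and C F :: "nat \<Rightarrow> 'a \<Rightarrow> real^'l^'n"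
    and b \<sigma> q :: "nat \<Rightarrow> 'a \<Rightarrow> real^'n"
    and L :: "nat \<Rightarrow> 'a \<Rightarrow> real^'n^'m" and R :: "nat \<Rightarrow> 'a \<Rightarrow> real^'m^'m"
    and \<rho> :: "nat \<Rightarrow> 'a \<Rightarrow> real^'m"
    and G :: "'a \<Rightarrow> real^'n^'n" and g :: "'a \<Rightarrow> real^'n"
    and \<delta> :: real and \<xi> :: "real^'n" and v :: "nat \<Rightarrow> 'a \<Rightarrow> real^'l"
  assumes A: "A \<in> Linf_proc M \<omega> {..<N}" and B: "B \<in> Linf_proc M \<omega> {..<N}"
    and C: "C \<in> Linf_proc M \<omega> {..<N}" and D: "D \<in> Linf_proc M \<omega> {..<N}"
    and E: "E \<in> Linf_proc M \<omega> {..<N}" and F: "F \<in> Linf_proc M \<omega> {..<N}"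
    and b: "b \<in> L2_proc M \<omega> {..<N}" and \<sigma>: "\<sigma> \<in> L2_proc M \<omega> {..<N}"
    and Q: "Q \<in> Linf_proc M \<omega> {..<N}" and L: "L \<in> Linf_proc M \<omega> {..<N}"
    and R: "R \<in> Linf_proc M \<omega> {..<N}"
    and q: "q \<in> L2_proc M \<omega> {..<N}" and \<rho>: "\<rho> \<in> L2_proc M \<omega> {..<N}"
    and G: "G \<in> Linf_rv M (past M \<omega> N)" and g: "g \<in> L2_rv M (past M \<omega> N)"
    and v: "v \<in> L2_proc M \<omega> {..<N}"
    and sym: "AE z in M. transpose (G z) = G z \<and>
      (\<forall>k<N. transpose (Q k z) = Q k z \<and> transpose (R k z) = R k z)"
    and \<delta>: "\<delta> > 0"
    and psd: "AE z in M. psd (G z) \<and> (\<forall>k<N. psd (R k z - \<delta> *\<^sub>R mat 1) \<and>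
      psd (Q k z - transpose (L k z) ** matrix_inv (R k z) ** L k z))"
begin

abbreviation "X \<equiv> \<lambda>u. state \<omega> A B C b D E F \<sigma> \<xi> u v"
abbreviation "Y \<equiv> response \<omega> A B D E"
abbreviation "J \<equiv> \<lambda>u. quadratic_cost M N G g Q L R q \<rho> (X u) u"
abbreviation "J' \<equiv> \<lambda>u w. first_variation M N G g Q L R q \<rho> (X u) u (Y w) w"
abbreviation "J2 \<equiv> \<lambda>w. quadratic_cost M N G (\<lambda>_. 0) Q L R (\<lambda>_ _. 0) (\<lambda>_ _. 0) (Y w) w"

sublocale cost_data M N G g Q L R q \<rho>
proof
  show "G \<in> Linf_rv M M" "g \<in> L2_rv M M"
    by (auto intro: Linf_rv_weaken[OF subalgebra_past G] L2_rv_weaken[OF subalgebra_past g])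
qed (auto intro: Linf_proc_rv Q L R L2_proc_rv q \<rho>)

lemma L2_pair_state: "u \<in> L2_proc M \<omega> {..<N} \<Longrightarrow> L2_pair (X u) u"
  by (auto simp: L2_pair_def intro: L2_proc_rv L2_rv_weaken[OF subalgebra_past state_L2[OF A B C b D E F \<sigma> _ v]])

lemma L2_pair_response: "w \<in> L2_proc M \<omega> {..<N} \<Longrightarrow> L2_pair (Y w) w"
  by (auto simp: L2_pair_def intro: L2_proc_rv L2_rv_weaken[OF subalgebra_past response_L2[OF A B D E]])

lemma cost_expansion:
  assumes "u \<in> L2_proc M \<omega> {..<N}" "w \<in> L2_proc M \<omega> {..<N}"
  shows "J (\<lambda>k z. u k z + t *\<^sub>R w k z) = J u + t * J' u w + t\<^sup>2 * J2 w"
proof -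
  have "X (\<lambda>k z. u k z + t *\<^sub>R w k z) = (\<lambda>k z. X u k z + t *\<^sub>R Y w k z)"
    by (intro ext) (rule state_perturb)
  then show ?thesis
    using quadratic_cost_perturb[OF L2_pair_state L2_pair_response sym] assms by simp
qed

text \<open>
  The direction enters the derivative through \<open>w\<close> itself and through its response, whose second
  moments are controlled by the norm of \<open>w\<close>.
\<close>

lemma J'_bound:
  assumes u: "u \<in> L2_proc M \<omega> {..<N}"
  obtains c where "\<And>w. w \<in> L2_proc M \<omega> {..<N} \<Longrightarrow> \<bar>J' u w\<bar> \<le> c * (1 + (L2_norm M {..<N} w)\<^sup>2)"
proof -
  let ?n = "\<lambda>w. (L2_norm M {..<N} w)\<^sup>2"
  obtain c where c: "\<And>y w. L2_pair y w \<Longrightarrow> \<bar>first_variation M N G g Q L R q \<rho> (X u) u y w\<bar>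
    \<le> c + (\<integral>z. (norm (y N z))\<^sup>2 \<partial>M) +
      (\<Sum>k<N. (\<integral>z. (norm (y k z))\<^sup>2 \<partial>M) + (\<integral>z. (norm (w k z))\<^sup>2 \<partial>M))"
    using first_variation_bound[OF L2_pair_state[OF u]] by blast
  obtain K where K: "\<And>k w. k \<le> N \<Longrightarrow> w \<in> L2_proc M \<omega> {..<N} \<Longrightarrow>
      (\<integral>z. (norm (Y w k z))\<^sup>2 \<partial>M) \<le> K k * ?n w"
    using response_bounded[OF A B D E] by metis
  define C where "C = K N + (\<Sum>k<N. K k + 1)"
  have "\<bar>J' u w\<bar> \<le> max c C * (1 + ?n w)" if w: "w \<in> L2_proc M \<omega> {..<N}" for w
  proof -
    have "\<bar>J' u w\<bar> \<le> c + (\<integral>z. (norm (Y w N z))\<^sup>2 \<partial>M) +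
        (\<Sum>k<N. (\<integral>z. (norm (Y w k z))\<^sup>2 \<partial>M) + (\<integral>z. (norm (w k z))\<^sup>2 \<partial>M))"
      by (rule c[OF L2_pair_response[OF w]])
    also have "\<dots> \<le> c + K N * ?n w + (\<Sum>k<N. K k * ?n w + ?n w)"
      using K[OF _ w] integral_norm2_le_L2_norm[OF w] by (intro add_mono sum_mono order_refl) auto
    also have "\<dots> = c + C * ?n w"
      by (simp add: C_def distrib_right sum_distrib_right)
    also have "\<dots> \<le> max c C * (1 + ?n w)"
      unfolding distrib_left by (intro add_mono mult_right_mono) auto
    finally show ?thesis .
  qed
  then show ?thesis
    by (rule that)
qed

lemma has_gateaux_derivative_cost:
  assumes u: "u \<in> L2_proc M \<omega> {..<N}"
  shows "has_gateaux_derivative (L2_proc M \<omega> {..<N}) (L2_norm M {..<N}) J (J' u) u"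
proof -
  obtain c where c: "\<And>w. w \<in> L2_proc M \<omega> {..<N} \<Longrightarrow> \<bar>J' u w\<bar> \<le> c * (1 + (L2_norm M {..<N} w)\<^sup>2)"
    using J'_bound[OF u] by blast
  show ?thesis
  proof (rule has_gateaux_derivative_if_quadratic[where c = c and q = J2])
    fix w1 w2 :: "nat \<Rightarrow> 'a \<Rightarrow> real^'m" and a d :: real
    assume w: "w1 \<in> L2_proc M \<omega> {..<N}" "w2 \<in> L2_proc M \<omega> {..<N}"
    have "Y (\<lambda>k z. a *\<^sub>R w1 k z + d *\<^sub>R w2 k z) = (\<lambda>k z. a *\<^sub>R Y w1 k z + d *\<^sub>R Y w2 k z)"
      by (intro ext) (rule response_linear)
    then show "J' u (\<lambda>k z. a *\<^sub>R w1 k z + d *\<^sub>R w2 k z) = a * J' u w1 + d * J' u w2"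
      using first_variation_linear[OF L2_pair_state[OF u] L2_pair_response L2_pair_response, OF w] by simp
  qed (simp_all add: L2_proc_scaleR L2_norm_nonneg L2_norm_scaleR c cost_expansion[OF u])
qed

lemma optimal_iff_stationary:
  assumes u: "u \<in> L2_proc M \<omega> {..<N}"
  shows "ereal (J u) = (INF v\<in>L2_proc M \<omega> {..<N}. ereal (J v)) \<longleftrightarrow>
    (\<forall>w\<in>L2_proc M \<omega> {..<N}. gateaux_deriv J u w = 0)"
proof -
  have sym_R: "AE z in M. \<forall>k<N. transpose (R k z) = R k z"
    using sym by (rule eventually_mono) simp
  have "(\<forall>v\<in>L2_proc M \<omega> {..<N}. J u \<le> J v) \<longleftrightarrow> (\<forall>w\<in>L2_proc M \<omega> {..<N}. J' u w = 0)"
    by (rule minimal_iff_stationary_if_convex_quadratic[where q = J2])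
       (use u L2_proc_add_scaleR cost_expansion[OF u] quadratic_cost_nonneg[OF \<delta> sym_R psd] in auto)
  then show ?thesis
    using eq_INF_ereal_iff_minimal[OF u, of J]
      has_gateaux_derivative_imp_gateaux_deriv[OF has_gateaux_derivative_cost[OF u]] by simp
qed

end

section \<open>Nash equilibria\<close>

theorem theorem3p3:
  fixes \<mu> :: "'a measure" and N :: nat and \<omega> :: "nat \<Rightarrow> 'a \<Rightarrow> real"
    and A D Q P :: "nat \<Rightarrow> 'a \<Rightarrow> real^'n^'n"
    and B E :: "nat \<Rightarrow> 'a \<Rightarrow> real^'m^'n"
    and C F :: "nat \<Rightarrow> 'a \<Rightarrow> real^'l^'n"
    and b \<sigma> q p :: "nat \<Rightarrow> 'a \<Rightarrow> real^'n"
    and L :: "nat \<Rightarrow> 'a \<Rightarrow> real^'n^'m" and M :: "nat \<Rightarrow> 'a \<Rightarrow> real^'n^'l"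
    and R :: "nat \<Rightarrow> 'a \<Rightarrow> real^'m^'m" and S :: "nat \<Rightarrow> 'a \<Rightarrow> real^'l^'l"
    and \<rho> :: "nat \<Rightarrow> 'a \<Rightarrow> real^'m" and \<theta> :: "nat \<Rightarrow> 'a \<Rightarrow> real^'l"
    and G H :: "'a \<Rightarrow> real^'n^'n" and g h :: "'a \<Rightarrow> real^'n"
    and \<delta> :: real and \<xi> :: "real^'n"
    and J1 J2 :: "(nat \<Rightarrow> 'a \<Rightarrow> real^'m) \<Rightarrow> (nat \<Rightarrow> 'a \<Rightarrow> real^'l) \<Rightarrow> real"
    and us :: "nat \<Rightarrow> 'a \<Rightarrow> real^'m" and vs :: "nat \<Rightarrow> 'a \<Rightarrow> real^'l"
  assumes "prob_space \<mu>" and "complete_measure \<mu>" and "N > 0" and "noise \<mu> N \<omega>"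
    and "A \<in> Linf_proc \<mu> \<omega> {..<N}" and "D \<in> Linf_proc \<mu> \<omega> {..<N}"
    and "B \<in> Linf_proc \<mu> \<omega> {..<N}" and "E \<in> Linf_proc \<mu> \<omega> {..<N}"
    and "C \<in> Linf_proc \<mu> \<omega> {..<N}" and "F \<in> Linf_proc \<mu> \<omega> {..<N}"
    and "b \<in> L2_proc \<mu> \<omega> {..<N}" and "\<sigma> \<in> L2_proc \<mu> \<omega> {..<N}"
    and "Q \<in> Linf_proc \<mu> \<omega> {..<N}" and "P \<in> Linf_proc \<mu> \<omega> {..<N}"
    and "L \<in> Linf_proc \<mu> \<omega> {..<N}" and "M \<in> Linf_proc \<mu> \<omega> {..<N}"
    and "R \<in> Linf_proc \<mu> \<omega> {..<N}" and "S \<in> Linf_proc \<mu> \<omega> {..<N}"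
    and "G \<in> Linf_rv \<mu> (past \<mu> \<omega> N)" and "H \<in> Linf_rv \<mu> (past \<mu> \<omega> N)"
    and "g \<in> L2_rv \<mu> (past \<mu> \<omega> N)" and "h \<in> L2_rv \<mu> (past \<mu> \<omega> N)"
    and "q \<in> L2_proc \<mu> \<omega> {..<N}" and "p \<in> L2_proc \<mu> \<omega> {..<N}"
    and "\<rho> \<in> L2_proc \<mu> \<omega> {..<N}" and "\<theta> \<in> L2_proc \<mu> \<omega> {..<N}"
    and "AE z in \<mu>. transpose (G z) = G z \<and> transpose (H z) = H z \<and>
           (\<forall>k<N. transpose (Q k z) = Q k z \<and> transpose (P k z) = P k z \<and>
                  transpose (R k z) = R k z \<and> transpose (S k z) = S k z)"
    and "\<delta> > 0"
    and "AE z in \<mu>. psd (G z) \<and> psd (H z) \<and>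
           (\<forall>k<N. psd (R k z - \<delta> *\<^sub>R mat 1) \<and> psd (S k z - \<delta> *\<^sub>R mat 1) \<and>
                  psd (Q k z - transpose (L k z) ** matrix_inv (R k z) ** L k z) \<and>
                  psd (P k z - transpose (M k z) ** matrix_inv (S k z) ** M k z))"
    and J1: "\<And>u v. J1 u v =
           quadratic_cost \<mu> N G g Q L R q \<rho> (state \<omega> A B C b D E F \<sigma> \<xi> u v) u"
    and J2: "\<And>u v. J2 u v =
           quadratic_cost \<mu> N H h P M S p \<theta> (state \<omega> A B C b D E F \<sigma> \<xi> u v) v"
    and "us \<in> L2_proc \<mu> \<omega> {..<N}" and "vs \<in> L2_proc \<mu> \<omega> {..<N}"
  shows "gateaux_differentiable (L2_proc \<mu> \<omega> {..<N}) (L2_norm \<mu> {..<N}) (\<lambda>u. J1 u vs) us \<and>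
         gateaux_differentiable (L2_proc \<mu> \<omega> {..<N}) (L2_norm \<mu> {..<N}) (\<lambda>v. J2 us v) vs \<and>
         (open_loop_nash (L2_proc \<mu> \<omega> {..<N}) (L2_proc \<mu> \<omega> {..<N}) J1 J2 us vs \<longleftrightarrow>
           (\<forall>w \<in> L2_proc \<mu> \<omega> {..<N}. gateaux_deriv (\<lambda>u. J1 u vs) us w = 0) \<and>
           (\<forall>z \<in> L2_proc \<mu> \<omega> {..<N}. gateaux_deriv (\<lambda>v. J2 us v) vs z = 0))"
proof -
  interpret noise_space \<mu> N \<omega>
    using assms(1,4) by (simp add: noise_space_def noise_space_axioms_def)
  have sym1: "AE z in \<mu>. transpose (G z) = G z \<and>
      (\<forall>k<N. transpose (Q k z) = Q k z \<and> transpose (R k z) = R k z)"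
    and sym2: "AE z in \<mu>. transpose (H z) = H z \<and>
      (\<forall>k<N. transpose (P k z) = P k z \<and> transpose (S k z) = S k z)"
    by (rule eventually_mono[OF assms(27)], simp)+
  have psd1: "AE z in \<mu>. psd (G z) \<and> (\<forall>k<N. psd (R k z - \<delta> *\<^sub>R mat 1) \<and>
      psd (Q k z - transpose (L k z) ** matrix_inv (R k z) ** L k z))"
    and psd2: "AE z in \<mu>. psd (H z) \<and> (\<forall>k<N. psd (S k z - \<delta> *\<^sub>R mat 1) \<and>
      psd (P k z - transpose (M k z) ** matrix_inv (S k z) ** M k z))"
    by (rule eventually_mono[OF assms(29)], simp)+
  interpret p1: lq_player \<mu> N \<omega> A D Q B E C F b \<sigma> q L R \<rho> G g \<delta> \<xi> vs
    by unfold_locales (rule assms sym1 psd1)+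
  interpret p2: lq_player \<mu> N \<omega> A D P C F B E b \<sigma> p M S \<theta> H h \<delta> \<xi> us
    by unfold_locales (rule assms sym2 psd2)+
  have J1': "(\<lambda>u. J1 u vs) = p1.J"
    by (simp add: J1)
  have J2': "(\<lambda>v. J2 us v) = p2.J"
    by (simp add: J2 state_swap[of \<omega> A B])
  show ?thesis
    using p1.has_gateaux_derivative_cost[of us] p1.optimal_iff_stationary[of us]
      p2.has_gateaux_derivative_cost[of vs] p2.optimal_iff_stationary[of vs] assms(32,33)
      J1'[THEN fun_cong] J2'[THEN fun_cong]
    unfolding open_loop_nash_def gateaux_differentiable_def J1' J2' by auto
qed

end
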